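(* Let $\mathcal{K}\subset\mathbb{R}^d$ be convex and compact with Euclidean diameter $D_{\mathcal{K}}$, let $f$ be convex and $\beta$-smooth over $\mathcal{K}$, accessed through a stochastic gradient oracle with stochastic gradients bounded in Euclidean norm by $G>0$, and suppose that $f,\mathcal{K}$ satisfy the quadratic growth property with some $\alpha>0$. Using the stochastic Frank-Wolfe algorithm with nearest extreme point oracle (described in the context) with step-sizes $\eta_t=\frac{2}{t+1}$ and mini-batch sizes $$m_t=\max\left\{\left(\frac{G(t+1)}{\beta D_{\mathcal{K}}}\right)^2,\ \min\left\{\left(\frac{GD_{\mathcal{K}}(t+1)}{\beta{D^*}^2}\right)^2,\left(\frac{\alpha G(t+1)^2}{8\beta^2D_{\mathcal{K}}}\right)^2\right\}\right\},$$ for any $0<\epsilon\le\frac{16\beta^2D_{\mathcal{K}}^2}{\alpha}$, expected approximation error $\epsilon$ (i.e. $\mathbb{E}[f(\mathbf{x}_t)-f^*]\le\epsilon$) is achieved after $$\tilde O\left(\max\left\{\frac{\beta{D^*}^2}{\epsilon},\frac{\beta D_{\mathcal{K}}}{\sqrt{\alpha\epsilon}}\right\}\right)$$ calls to the nearest extreme point oracle and $$\tilde O\left(\beta G^2\max\left\{\frac{D_{\mathcal{K}}^2{D^*}^2}{\epsilon^3},\ \frac{D_{\mathcal{K}}}{\alpha^{3/2}\epsilon^{3/2}},\ \frac{D_{\mathcal{K}}^3}{\alpha^{1/2}\epsilon^{5/2}}\right\}\right)$$ stochastic gradient evaluations, where $\tilde O$ suppresses poly-logarithmic terms in $\frac{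\beta^2D_{\mathcal{K}}^2}{\alpha\epsilon}$.
   Context: $\|\cdot\|$ is the Euclidean norm, $\mathrm{dist}$ the Euclidean distance, and $\mathcal{V}$ is the set of extreme points of $\mathcal{K}$. $\beta$-smooth over $\mathcal{K}$ ($\beta>0$): $f$ is differentiable and $\|\nabla f(\mathbf{x})-\nabla f(\mathbf{y})\|\le\beta\|\mathbf{x}-\mathbf{y}\|$ for all $\mathbf{x},\mathbf{y}\in\mathcal{K}$. $f^*=\min_{\mathcal{K}}f$, $\mathcal{X}^*=\arg\min_{\mathbf{x}\in\mathcal{K}}f(\mathbf{x})$. Quadratic growth with parameter $\alpha>0$: $\mathrm{dist}(\mathbf{x},\mathcal{X}^* )^2\le2\alpha^{-1}(f(\mathbf{x})-f^* )$ for all $\mathbf{x}\in\mathcal{K}$. $S^*\in\arg\min_{S\subseteq\mathcal{V}}\{\max_{\mathbf{u},\mathbf{v}\in S}\|\mathbf{v}-\mathbf{u}\| : \mathcal{X}^*\subseteq\mathrm{conv}(S)\}$ and $D^*=\max_{\mathbf{u},\mathbf{v}\in S^*}\|\mathbf{v}-\mathbf{u}\|$, i.e. $D^*$ is the smallest diameter of a set of extreme points whose convex hull contains $\mathcal{X}^*$. (If $D^*=0$, the first term in the inner minimum in the formula for $m_t$ is read as $+\infty$.) Stochastic oracle: for a query $\mathbf{x}\in\mathcal{K}$ it returns an unbiased random estimator of $\nabla f(\mathbf{x})$ with Euclidean norm at most $G$. Stochastic Frank-Wolfe with nearest extreme point oracle, with step-sizes $\{\eta_t\}\subset[0,1]$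 and mini-batch sizes $\{m_t\}$: $\mathbf{x}_1\in\mathcal{V}$ is arbitrary; for $t=1,2,\dots$: compute $\tilde\nabla_t$ as the average of $m_t$ i.i.d. unbiased estimators of $\nabla f(\mathbf{x}_t)$ obtained from the stochastic oracle; compute $\mathbf{v}_t\in\arg\min_{\mathbf{v}\in\mathcal{V}}\mathbf{v}^\top\tilde\nabla_t+\frac{\beta\eta_t}{2}\|\mathbf{x}_t-\mathbf{v}\|^2$ (one call to the nearest extreme point oracle); set $\mathbf{x}_{t+1}=(1-\eta_t)\mathbf{x}_t+\eta_t\mathbf{v}_t$. *)

theory Defs
  imports "HOL-Probability.Probability"
begin

definition minimizers :: "'a set \<Rightarrow> ('a \<Rightarrow> real) \<Rightarrow> 'a set" where
  "minimizers K f = {x. is_arg_min f (\<lambda>y. y \<in> K) x}"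

text \<open>The gradient map \<open>f'\<close> is a parameter, and differentiability is taken within \<open>K\<close>, so that
  \<open>f\<close> need only be given on \<open>K\<close> (and \<open>K\<close> may have empty interior). A function differentiable on
  a neighbourhood of \<open>K\<close> satisfies this with its ordinary gradient.\<close>

definition smooth_over :: "real \<Rightarrow> 'a::euclidean_space set \<Rightarrow> ('a \<Rightarrow> real) \<Rightarrow> ('a \<Rightarrow> 'a) \<Rightarrow> bool" where
  "smooth_over \<beta> K f f' \<longleftrightarrow>
     (\<forall>x\<in>K. (f has_derivative (\<lambda>h. f' x \<bullet> h)) (at x within K)) \<and>
     (\<forall>x\<in>K. \<forall>y\<in>K. norm (f' x - f' y) \<le> \<beta> * norm (x - y))"

definition quadratic_growth :: "real \<Rightarrow> 'a::euclidean_space set \<Rightarrow> ('a \<Rightarrow> real) \<Rightarrow> bool" where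
  "quadratic_growth \<alpha> K f \<longleftrightarrow>
     (\<forall>x\<in>K. (infdist x (minimizers K f))\<^sup>2 \<le> 2 / \<alpha> * (f x - (INF y\<in>K. f y)))"

text \<open>The oracle is a Markov kernel: \<open>Orc x\<close> is the law of its answer to the query \<open>x\<close>.\<close>

definition stochastic_gradient_oracle ::
    "'a::euclidean_space set \<Rightarrow> ('a \<Rightarrow> 'a) \<Rightarrow> real \<Rightarrow> ('a \<Rightarrow> 'a measure) \<Rightarrow> bool" where
  "stochastic_gradient_oracle K f' G Orc \<longleftrightarrow>
     Orc \<in> restrict_space borel K \<rightarrow>\<^sub>M prob_algebra borel \<and>
     (\<forall>x\<in>K. (AE g in Orc x. norm g \<le> G) \<and> has_bochner_integral (Orc x) (\<lambda>g. g) (f' x))"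

text \<open>A run of the algorithm; iterations are numbered from 1. \<open>F t\<close> is the information available
  before iteration \<open>t\<close>, \<open>g t i\<close> is the \<open>i\<close>-th sample of iteration \<open>t\<close>, and \<open>fresh_samples\<close> says that,
  conditionally on \<open>F t\<close>, the samples \<open>g t 0, \<dots>, g t (m t - 1)\<close> are i.i.d. with law
  \<open>Orc (x t)\<close>. Ties in the nearest extreme point oracle may be broken in any way that does not
  look at future samples.\<close>

locale stochastic_nep_frank_wolfe =
  prob_space M + filtration "space M" F
  for M :: "'w measure" and F :: "nat \<Rightarrow> 'w measure" +
  fixes K :: "'a::euclidean_space set" and Orc :: "'a \<Rightarrow> 'a measure" and \<beta> :: real
    and \<eta> :: "nat \<Rightarrow> real" and m :: "nat \<Rightarrow> nat"
    and x v :: "nat \<Rightarrow> 'w \<Rightarrow> 'a" and g :: "nat \<Rightarrow> nat \<Rightarrow> 'w \<Rightarrow> 'a"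
  assumes subalgebra_F: "subalgebra M (F t)"
    and x_adapted: "1 \<le> t \<Longrightarrow> x t \<in> borel_measurable (F t)"
    and v_adapted: "1 \<le> t \<Longrightarrow> v t \<in> borel_measurable (F (Suc t))"
    and g_adapted: "1 \<le> t \<Longrightarrow> i < m t \<Longrightarrow> g t i \<in> borel_measurable (F (Suc t))"
    and fresh_samples: "1 \<le> t \<Longrightarrow> A \<in> sets (F t) \<Longrightarrow> (\<And>i. i < m t \<Longrightarrow> B i \<in> sets borel) \<Longrightarrow>
      prob (A \<inter> {\<omega> \<in> space M. \<forall>i<m t. g t i \<omega> \<in> B i}) =
      (\<integral>\<omega>. indicator A \<omega> * (\<Prod>i<m t. measure (Orc (x t \<omega>)) (B i)) \<partial>M)"
    and init: "\<omega> \<in> space M \<Longrightarrow> x 1 \<omega> extreme_point_of K"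
    and nep_step: "1 \<le> t \<Longrightarrow> \<omega> \<in> space M \<Longrightarrow>
      is_arg_min
        (\<lambda>u. u \<bullet> ((1 / real (m t)) *\<^sub>R (\<Sum>i<m t. g t i \<omega>)) + \<beta> * \<eta> t / 2 * (norm (x t \<omega> - u))\<^sup>2)
        (\<lambda>u. u extreme_point_of K) (v t \<omega>)"
    and x_step: "1 \<le> t \<Longrightarrow> \<omega> \<in> space M \<Longrightarrow>
      x (Suc t) \<omega> = (1 - \<eta> t) *\<^sub>R x t \<omega> + \<eta> t *\<^sub>R v t \<omega>"

text \<open>\<open>D\<close> is the diameter of the feasible set and \<open>Ds\<close> the diameter \<open>D\<^sup>*\<close>. The prescribed value is
  real, so it is rounded up to get a batch size. For \<open>Ds = 0\<close> the quotient by \<open>Ds\<^sup>2\<close> counts as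
  infinite.\<close>

definition batch_size :: "real \<Rightarrow> real \<Rightarrow> real \<Rightarrow> real \<Rightarrow> real \<Rightarrow> nat \<Rightarrow> nat" where
  "batch_size \<alpha> \<beta> G D Ds t = nat \<lceil>max
     ((G * (real t + 1) / (\<beta> * D))\<^sup>2)
     (let q = (\<alpha> * G * (real t + 1)\<^sup>2 / (8 * \<beta>\<^sup>2 * D))\<^sup>2
      in if Ds = 0 then q else min ((G * D * (real t + 1) / (\<beta> * Ds\<^sup>2))\<^sup>2) q)\<rceil>"

text \<open>\<open>a \<le> soft_O z b\<close> reads: \<open>a\<close> is \<open>O(b)\<close> up to a poly-logarithmic factor in \<open>z\<close>. The constant and
  the exponent hidden by the notation are absolute; they are given as numerals because constants
  quantified existentially in a statement over a type of class \<open>euclidean_space\<close> could depend on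
  that type, hence on the dimension. The numerals are not optimized.\<close>

definition soft_O :: "real \<Rightarrow> real \<Rightarrow> real" where
  "soft_O z b = 10 ^ 7 * (1 + \<bar>ln z\<bar>) ^ 3 * b"

end

theory Submission
  imports Defs
begin

text \<open>
  With \<open>e\<^sub>t = E[f (x\<^sub>t) - f\<^sup>*]\<close> and \<open>N\<^sub>t\<close> the error of the averaged gradient, optimality of \<open>v\<^sub>t\<close>,
  compared with the points of \<open>S\<^sup>*\<close> averaged to the minimizer nearest to \<open>x\<^sub>t\<close>, gives
  \<open>e\<^sub>t\<^sub>+\<^sub>1 \<le> (1 - \<eta>\<^sub>t) e\<^sub>t + \<eta>\<^sub>t D E[N\<^sub>t] + \<beta> \<eta>\<^sub>t\<^sup>2 R / 2\<close>, where \<open>R\<close> may be \<open>D\<^sup>2\<close> or, by quadratic growth,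
  \<open>2 e\<^sub>t / \<alpha> + D\<^sup>*\<^sup>2\<close>. Since the samples are conditionally i.i.d., \<open>E[N\<^sub>t]\<close> is at most \<open>G / sqrt m\<^sub>t\<close>, which the
  batch sizes make comparable to the last term. The first choice of \<open>R\<close> gives \<open>e\<^sub>t \<le> 4 \<beta> D\<^sup>2 / t\<close>;
  inserting this into the second gives
  \<open>e\<^sub>t \<le> 4 \<beta> D\<^sup>*\<^sup>2 / t + 68 (\<beta>\<^sup>2 D\<^sup>2 / \<alpha>) (1 + ln t) / t\<^sup>2\<close>. The stopping time is the point at which both
  summands are below \<open>\<epsilon> / 2\<close>, except that nothing has to be done if \<open>G D \<le> \<epsilon>\<close>; the remaining case
  \<open>\<epsilon> < G D\<close> is the one in which rounding up the batch sizes is affordable.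
\<close>

section \<open>One step of the method\<close>

lemma has_derivative_along_segment:
  fixes K :: "'a::euclidean_space set"
  assumes "convex K" "smooth_over \<beta> K f f'" "x \<in> K" "y \<in> K"
  defines "p \<equiv> \<lambda>s. x + s *\<^sub>R (y - x)"
  assumes s: "s \<in> {0..1::real}"
  shows "p s \<in> K" and "((\<lambda>s. f (p s)) has_derivative (\<lambda>h. h * (f' (p s) \<bullet> (y - x)))) (at s within {0..1})"
proof -
  have pK: "p s \<in> K" if "s \<in> {0..1}" for s
  proof -
    have "p s = (1 - s) *\<^sub>R x + s *\<^sub>R y" by (simp add: p_def algebra_simps)
    then show ?thesis using assms(1,3,4) that by (simp add: convexD)
  qed
  then show pK': "p s \<in> K" using s by blast
  have 1: "(p has_derivative (\<lambda>h. h *\<^sub>R (y - x))) (at s within {0..1})"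
    unfolding p_def by (auto intro!: derivative_eq_intros)
  \<comment> \<open>\<open>f\<close> is differentiable only within \<open>K\<close>; the segment
    lies in \<open>K\<close> by convexity, so the derivative is restricted to it before
    composing.\<close>
  have 2: "(f has_derivative (\<lambda>h. f' (p s) \<bullet> h)) (at (p s) within p ` {0..1})"
    using assms(2) pK' pK unfolding smooth_over_def by (meson has_derivative_subset image_subsetI)
  show "((\<lambda>s. f (p s)) has_derivative (\<lambda>h. h * (f' (p s) \<bullet> (y - x)))) (at s within {0..1})"
    using has_derivative_in_compose[OF 1 2] by simp
qed

text \<open>The mean value theorem replaces integration of the gradient along the segment:
  \<open>\<psi>\<close> subtracts the linear part and the claimed quadratic from \<open>f\<close>,
  and Lipschitz continuity of \<open>f'\<close> makes its derivative nonpositive.\<close>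

lemma smooth_over_upper_bound:
  fixes K :: "'a::euclidean_space set"
  assumes "convex K" "smooth_over \<beta> K f f'" "x \<in> K" "y \<in> K"
  shows "f y \<le> f x + f' x \<bullet> (y - x) + \<beta> / 2 * (norm (y - x))\<^sup>2"
proof -
  define p where "p = (\<lambda>s. x + s *\<^sub>R (y - x))"
  define \<psi> where "\<psi> s = f (p s) - s * (f' x \<bullet> (y - x)) - \<beta> / 2 * s\<^sup>2 * (norm (y - x))\<^sup>2" for s :: real
  define \<psi>' where "\<psi>' s = (\<lambda>h. h * (f' (p s) \<bullet> (y - x) - f' x \<bullet> (y - x) - \<beta> * s * (norm (y - x))\<^sup>2))" for s :: real
  have "(\<psi> has_derivative \<psi>' s) (at s within {0..1})" if "s \<in> {0..1}" for s
  proof -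
    have d: "((\<lambda>s. f (p s)) has_derivative (\<lambda>h. h * (f' (p s) \<bullet> (y - x)))) (at s within {0..1})"
      unfolding p_def by (rule has_derivative_along_segment(2)[OF assms that])
    show ?thesis
      unfolding \<psi>_def \<psi>'_def
      by (auto intro!: derivative_eq_intros d simp: algebra_simps power2_eq_square)
  qed
  then obtain s where s: "s \<in> {0<..<1}" "\<psi> 1 - \<psi> 0 = \<psi>' s (1 - 0)"
    using mvt_simple[of 0 1 \<psi> \<psi>'] by auto
  have "(f' (p s) - f' x) \<bullet> (y - x) \<le> norm (f' (p s) - f' x) * norm (y - x)"
    by (rule norm_cauchy_schwarz)
  also have "norm (f' (p s) - f' x) \<le> \<beta> * norm (p s - x)"
    using assms(2,3) s has_derivative_along_segment(1)[OF assms, of s] unfolding smooth_over_def p_def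
    by (meson greaterThanLessThan_subseteq_atLeastAtMost_iff order_refl subsetD)
  also have "norm (p s - x) = s * norm (y - x)" using s by (simp add: p_def)
  finally have "(f' (p s) - f' x) \<bullet> (y - x) \<le> \<beta> * s * (norm (y - x))\<^sup>2"
    by (simp add: mult_right_mono power2_eq_square algebra_simps)
  then have "\<psi> 1 \<le> \<psi> 0" using s by (simp add: \<psi>'_def inner_diff_left)
  then show ?thesis by (simp add: \<psi>_def p_def)
qed

text \<open>Convexity bounds every difference quotient from \<open>x\<close> towards
  \<open>y\<close> by \<open>f y - f x\<close>, and the gradient term is their one-sided
  limit.\<close>

lemma convex_on_above_gradient:
  fixes K :: "'a::euclidean_space set"
  assumes "convex K" "smooth_over \<beta> K f f'" "convex_on K f" "x \<in> K" "y \<in> K"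
  shows "f x + f' x \<bullet> (y - x) \<le> f y"
proof -
  define p where "p = (\<lambda>s. x + s *\<^sub>R (y - x))"
  have "((\<lambda>s. f (p s)) has_field_derivative (f' (p 0) \<bullet> (y - x))) (at 0 within {0..1})"
    using has_derivative_along_segment(2)[OF assms(1,2,4,5), of 0]
    by (simp add: has_field_derivative_def p_def mult_commute_abs)
  then have "((\<lambda>s. (f (p s) - f (p 0)) / (s - 0)) \<longlongrightarrow> f' (p 0) \<bullet> (y - x)) (at 0 within {0..1})"
    by (simp add: has_field_derivative_iff)
  then have lim: "((\<lambda>s. (f (p s) - f x) / s) \<longlongrightarrow> f' x \<bullet> (y - x)) (at 0 within {0..1})"
    by (simp add: p_def)
  have "(f (p s) - f x) / s \<le> f y - f x" if "s \<in> {0<..1}" for s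
  proof -
    have "p s = (1 - s) *\<^sub>R x + s *\<^sub>R y" by (simp add: p_def algebra_simps)
    then have "f (p s) \<le> (1 - s) * f x + s * f y"
      using convex_onD[OF assms(3), of s x y] that assms by auto
    then show ?thesis using that by (simp add: field_simps)
  qed
  then have "eventually (\<lambda>s. (f (p s) - f x) / s \<le> f y - f x) (at 0 within {0..1})"
    unfolding eventually_at by (intro exI[of _ 1]) (auto simp: dist_real_def)
  moreover have "at (0::real) within {0..1} \<noteq> bot"
    by (simp add: at_within_Icc_at_right)
  ultimately show ?thesis using tendsto_upperbound[OF lim] by force
qed

text \<open>A point \<open>w\<close> of the hull need not be extreme and so need not compete with
  \<open>v\<close>. An affine majorant of \<open>\<Phi>\<close> on \<open>S\<close> bridges this: it
  is at least \<open>\<Phi> v\<close> on \<open>S\<close>, hence on the hull, because a half-space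
  is convex.\<close>

lemma is_arg_min_on_convex_hull:
  assumes "is_arg_min \<Phi> (\<lambda>u. u \<in> V) v" and "S \<subseteq> V" and "w \<in> convex hull S"
    and "\<And>s. s \<in> S \<Longrightarrow> \<Phi> s \<le> s \<bullet> q + c"
  shows "\<Phi> v \<le> w \<bullet> q + (c :: real)"
proof -
  have "S \<subseteq> {u. q \<bullet> u \<ge> \<Phi> v - c}"
    using assms(1,2,4) by (fastforce simp: is_arg_min_linorder inner_commute)
  then have "convex hull S \<subseteq> {u. q \<bullet> u \<ge> \<Phi> v - c}"
    by (intro hull_minimal convex_halfspace_ge)
  then show ?thesis using assms(3) by (auto simp: inner_commute)
qed

section \<open>Minimizers, diameters and the deterministic one-step inequality\<close>

locale smooth_convex_problem =
  fixes K :: "'a::euclidean_space set" and f :: "'a \<Rightarrow> real" and f' :: "'a \<Rightarrow> 'a"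
    and \<alpha> \<beta> :: real and S :: "'a set"
  assumes convex_K: "convex K" and compact_K: "compact K" and K_nonempty: "K \<noteq> {}"
    and convex_f: "convex_on K f" and smooth_f: "smooth_over \<beta> K f f'" and \<beta>_pos: "\<beta> > 0"
    and \<alpha>_pos: "\<alpha> > 0" and growth: "quadratic_growth \<alpha> K f"
    and S_extreme: "S \<subseteq> {u. u extreme_point_of K}"
    and minimizers_in_hull: "minimizers K f \<subseteq> convex hull S"
begin

definition gap :: "'a \<Rightarrow> real" where "gap y = f y - (INF y\<in>K. f y)"

lemma continuous_f: "continuous_on K f"
  using smooth_f unfolding smooth_over_def
  by (meson continuous_on_eq_continuous_within has_derivative_continuous)

lemma continuous_f': "continuous_on K f'"
proof -
  have "\<beta>-lipschitz_on K f'"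
    using smooth_f \<beta>_pos unfolding smooth_over_def by (intro lipschitz_onI) (auto simp: dist_norm)
  then show ?thesis by (rule lipschitz_on_continuous_on)
qed

lemma minimizers_eq: "minimizers K f = {y \<in> K. f y = (INF y\<in>K. f y)}"
  and minimizers_nonempty: "minimizers K f \<noteq> {}"
  and gap_nonneg: "y \<in> K \<Longrightarrow> 0 \<le> gap y"
proof -
  obtain z where z: "z \<in> K" "\<And>y. y \<in> K \<Longrightarrow> f z \<le> f y"
    using continuous_attains_inf[OF compact_K K_nonempty continuous_f] by blast
  have inf: "(INF y\<in>K. f y) = f z" by (rule cInf_eq_minimum) (use z in auto)
  show "minimizers K f = {y \<in> K. f y = (INF y\<in>K. f y)}"
    unfolding inf minimizers_def is_arg_min_linorder using z by (auto intro: antisym)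
  then show "minimizers K f \<noteq> {}" using inf z by auto
  show "y \<in> K \<Longrightarrow> 0 \<le> gap y" using inf z by (simp add: gap_def)
qed

text \<open>Quadratic growth speaks of an infimum of distances. The minimizers form a closed level
  set of \<open>f\<close> in \<open>K\<close>, so that infimum is attained at an actual
  point.\<close>

lemma nearest_minimizer:
  assumes "y \<in> K"
  obtains w where "w \<in> minimizers K f" "w \<in> K" "(norm (y - w))\<^sup>2 \<le> 2 / \<alpha> * gap y"
proof -
  have "closed (minimizers K f)"
  proof -
    have "closedin (top_of_set K) (K \<inter> f -` {INF y\<in>K. f y})"
      by (intro continuous_closedin_preimage continuous_f) auto
    then have "closed (K \<inter> f -` {INF y\<in>K. f y})"
      using compact_K compact_imp_closed closedin_closed_trans by blast
    moreover have "K \<inter> f -` {INF y\<in>K. f y} = minimizers K f" unfolding minimizers_eq by auto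
    ultimately show ?thesis by simp
  qed
  from infdist_attains_inf[OF this minimizers_nonempty]
  obtain w where "w \<in> minimizers K f" "infdist y (minimizers K f) = dist y w" by blast
  then show thesis using that growth assms minimizers_eq
    unfolding quadratic_growth_def gap_def dist_norm by fastforce
qed

lemma norm_le_diameter: "y \<in> K \<Longrightarrow> z \<in> K \<Longrightarrow> norm (y - z) \<le> diameter K"
  using diameter_bounded_bound[OF compact_imp_bounded[OF compact_K]] by (simp add: dist_norm)

lemma S_subset: "S \<subseteq> K"
  using S_extreme by (auto simp: extreme_point_of_def)

lemma diameter_S_le: "diameter S \<le> diameter K"
  using diameter_subset[OF S_subset] compact_K compact_imp_bounded by blast

lemma diameter_S_nonneg: "0 \<le> diameter S"
  by (meson S_subset bounded_subset compact_K compact_imp_bounded diameter_ge_0)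

text \<open>A ball of radius \<open>diameter S\<close> around a point of \<open>S\<close> contains
  \<open>S\<close> and, being convex, its hull.\<close>

lemma norm_hull_le_diameter:
  assumes "w \<in> convex hull S" "s \<in> S"
  shows "norm (w - s) \<le> diameter S"
proof -
  have "bounded S" using S_subset compact_K compact_imp_bounded bounded_subset by blast
  then have "S \<subseteq> cball s (diameter S)" using assms(2) diameter_bounded_bound by auto
  then have "convex hull S \<subseteq> cball s (diameter S)" by (intro hull_minimal) auto
  then show ?thesis using assms(1) by (auto simp: dist_norm norm_minus_commute)
qed

lemma gap_le_gradient:
  assumes "y \<in> K" "w \<in> minimizers K f"
  shows "gap y \<le> f' y \<bullet> (y - w)"
proof -
  have "w \<in> K" "f w = (INF y\<in>K. f y)" using assms minimizers_eq by auto
  then show ?thesis using convex_on_above_gradient[OF convex_K smooth_f convex_f assms(1), of w]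
    by (simp add: gap_def inner_diff_right)
qed

text \<open>The two bounds come from two affine majorants of the objective on \<open>S\<close>:
  either every distance is estimated by \<open>diameter K\<close>, or the square is expanded about
  \<open>w\<close>, which leaves only distances within the hull of \<open>S\<close>.\<close>

lemma nearest_extreme_point_le:
  assumes arg: "is_arg_min (\<lambda>u. u \<bullet> p + c * (norm (y - u))\<^sup>2) (\<lambda>u. u extreme_point_of K) v"
    and y: "y \<in> K" and w: "w \<in> minimizers K f" and c: "0 \<le> c"
  shows "v \<bullet> p + c * (norm (y - v))\<^sup>2 \<le> w \<bullet> p + c * (diameter K)\<^sup>2"
    and "v \<bullet> p + c * (norm (y - v))\<^sup>2 \<le> w \<bullet> p + c * ((norm (y - w))\<^sup>2 + (diameter S)\<^sup>2)"
proof -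
  define \<Phi> where "\<Phi> = (\<lambda>u. u \<bullet> p + c * (norm (y - u))\<^sup>2)"
  have arg': "is_arg_min \<Phi> (\<lambda>u. u \<in> {u. u extreme_point_of K}) v" using arg by (simp add: \<Phi>_def)
  have w': "w \<in> convex hull S" using w minimizers_in_hull by blast
  have 1: "\<Phi> s \<le> s \<bullet> p + c * (diameter K)\<^sup>2" if "s \<in> S" for s
    using norm_le_diameter[of y s] that S_subset y c
    by (auto simp: \<Phi>_def intro!: mult_left_mono power_mono)
  show "v \<bullet> p + c * (norm (y - v))\<^sup>2 \<le> w \<bullet> p + c * (diameter K)\<^sup>2"
    using is_arg_min_on_convex_hull[OF arg' S_extreme w' 1] by (simp add: \<Phi>_def)
  \<comment> \<open>When \<open>norm (y - s)\<close> squared is expanded about \<open>w\<close>, the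
    cross term is affine in \<open>s\<close>; its linear part goes into \<open>?q\<close> and its
    constant into \<open>?c\<close>. At \<open>s = w\<close> the two cancel.\<close>
  let ?q = "p - (2 * c) *\<^sub>R (y - w)"
  let ?c = "c * ((norm (y - w))\<^sup>2 + (diameter S)\<^sup>2) + 2 * c * ((y - w) \<bullet> w)"
  have 2: "\<Phi> s \<le> s \<bullet> ?q + ?c" if "s \<in> S" for s
  proof -
    have "(norm (y - s))\<^sup>2 = (norm (y - w))\<^sup>2 + 2 * ((y - w) \<bullet> (w - s)) + (norm (w - s))\<^sup>2"
      unfolding power2_norm_eq_inner by (simp add: inner_diff inner_commute algebra_simps)
    also have "\<dots> \<le> (norm (y - w))\<^sup>2 + 2 * ((y - w) \<bullet> (w - s)) + (diameter S)\<^sup>2"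
      using norm_hull_le_diameter[OF w' that] by (simp add: power_mono)
    finally have "c * (norm (y - s))\<^sup>2 \<le> c * \<dots>" using c by (rule mult_left_mono)
    then show ?thesis by (simp add: \<Phi>_def inner_diff inner_commute algebra_simps)
  qed
  show "v \<bullet> p + c * (norm (y - v))\<^sup>2 \<le> w \<bullet> p + c * ((norm (y - w))\<^sup>2 + (diameter S)\<^sup>2)"
    using is_arg_min_on_convex_hull[OF arg' S_extreme w' 2]
    by (simp add: \<Phi>_def inner_diff inner_commute algebra_simps)
qed

text \<open>Here \<open>p\<close> is any estimate of the gradient. Its error is paired with
  \<open>v - w\<close>, a difference of two points of \<open>K\<close>, which is why it costs a
  factor \<open>diameter K\<close>.\<close>

lemma gap_step:
  assumes arg: "is_arg_min (\<lambda>u. u \<bullet> p + \<beta> * e / 2 * (norm (y - u))\<^sup>2) (\<lambda>u. u extreme_point_of K) v"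
    and y: "y \<in> K" and e: "0 \<le> e" "e \<le> 1"
  defines "z \<equiv> (1 - e) *\<^sub>R y + e *\<^sub>R v"
  shows "gap z \<le> (1 - e) * gap y + e * diameter K * norm (f' y - p) + \<beta> * e\<^sup>2 / 2 * (diameter K)\<^sup>2" (is ?th1)
    and "gap z \<le> (1 - e) * gap y + e * diameter K * norm (f' y - p)
        + \<beta> * e\<^sup>2 / 2 * (2 / \<alpha> * gap y + (diameter S)\<^sup>2)" (is ?th2)
proof -
  obtain w where w: "w \<in> minimizers K f" "w \<in> K" "(norm (y - w))\<^sup>2 \<le> 2 / \<alpha> * gap y"
    using nearest_minimizer[OF y] by blast
  have v: "v \<in> K" using arg by (simp add: is_arg_min_linorder extreme_point_of_def)
  have z: "z \<in> K" unfolding z_def using y v convex_K e by (simp add: convexD)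
  have zy: "z - y = e *\<^sub>R (v - y)" by (simp add: z_def algebra_simps)
  have c: "0 \<le> \<beta> * e / 2" using \<beta>_pos e by simp
  have noise: "(f' y - p) \<bullet> (v - w) \<le> diameter K * norm (f' y - p)"
    using norm_cauchy_schwarz[of "f' y - p" "v - w"]
      mult_left_mono[OF norm_le_diameter[OF v w(2)], of "norm (f' y - p)"]
    by (simp add: mult.commute)
  \<comment> \<open>\<open>R\<close> stands for either bound on the quadratic part of the objective.
    The weight \<open>\<beta> * e / 2\<close> is the one for which the term in
    \<open>norm (y - v)\<close> cancels against that of the smoothness bound.\<close>
  have key: "gap z \<le> (1 - e) * gap y + e * diameter K * norm (f' y - p) + \<beta> * e\<^sup>2 / 2 * R"
    if R: "v \<bullet> p + \<beta> * e / 2 * (norm (y - v))\<^sup>2 \<le> w \<bullet> p + \<beta> * e / 2 * R" for R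
  proof -
    have "gap z \<le> gap y + e * (f' y \<bullet> (v - y)) + \<beta> / 2 * (e\<^sup>2 * (norm (y - v))\<^sup>2)"
      using smooth_over_upper_bound[OF convex_K smooth_f y z]
      by (simp add: gap_def zy power_mult_distrib norm_minus_commute)
    \<comment> \<open>Inserting \<open>p\<close> and \<open>w\<close> separates the gradient error,
      the difference controlled by optimality of \<open>v\<close>, and the first-order
      decrease.\<close>
    also have "f' y \<bullet> (v - y) = (f' y - p) \<bullet> (v - w) + (v \<bullet> p - w \<bullet> p) - f' y \<bullet> (y - w)"
      by (simp add: inner_diff inner_commute)
    also have "e * \<dots> \<le> e * (diameter K * norm (f' y - p)
        + (\<beta> * e / 2 * R - \<beta> * e / 2 * (norm (y - v))\<^sup>2) - gap y)"
      using noise R gap_le_gradient[OF y w(1)] e by (intro mult_left_mono) auto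
    finally show ?thesis by (simp add: algebra_simps power2_eq_square)
  qed
  show ?th1 by (rule key[OF nearest_extreme_point_le(1)[OF arg y w(1) c]])
  have "\<beta> * e\<^sup>2 / 2 * ((norm (y - w))\<^sup>2 + (diameter S)\<^sup>2) \<le> \<beta> * e\<^sup>2 / 2 * (2 / \<alpha> * gap y + (diameter S)\<^sup>2)"
    using w(3) \<beta>_pos by (intro mult_left_mono) auto
  with key[OF nearest_extreme_point_le(2)[OF arg y w(1) c]] show ?th2 by linarith
qed

text \<open>The first iteration moves to an extreme point. Comparing with the minimizer nearest to the new
  point, every error term is at most proportional to the distance from it, which quadratic growth
  absorbs; \<^const>\<open>gap\<close> at the starting point does not enter.\<close>

lemma gap_first_step:
  assumes arg: "is_arg_min (\<lambda>u. u \<bullet> p + \<beta> / 2 * (norm (y - u))\<^sup>2) (\<lambda>u. u extreme_point_of K) v"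
    and y: "y \<in> K"
  shows "gap v \<le> 16 * (\<beta>\<^sup>2 * (diameter K)\<^sup>2 / \<alpha>) + 4 / \<alpha> * (norm (f' y - p))\<^sup>2 + \<beta> * (diameter S)\<^sup>2"
proof -
  have v: "v \<in> K" using arg by (simp add: is_arg_min_linorder extreme_point_of_def)
  obtain w where w: "w \<in> minimizers K f" "w \<in> K" "(norm (v - w))\<^sup>2 \<le> 2 / \<alpha> * gap v"
    using nearest_minimizer[OF v] by blast
  define r N D where "r = norm (v - w)" and "N = norm (f' y - p)" and "D = diameter K"
  have r: "0 \<le> r" and D: "norm (y - v) \<le> D" "norm (y - w) \<le> D"
    using y v w norm_le_diameter by (auto simp: r_def D_def)
  have 1: "(f' v - f' y) \<bullet> (v - w) \<le> \<beta> * D * r"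
  proof -
    have "(f' v - f' y) \<bullet> (v - w) \<le> norm (f' v - f' y) * r"
      unfolding r_def by (rule norm_cauchy_schwarz)
    also have "norm (f' v - f' y) \<le> \<beta> * norm (v - y)"
      using smooth_f v y by (simp add: smooth_over_def)
    also have "\<dots> \<le> \<beta> * D" using D \<beta>_pos by (simp add: norm_minus_commute)
    finally show ?thesis using r by (simp add: mult_right_mono)
  qed
  have 2: "(f' y - p) \<bullet> (v - w) \<le> N * r" unfolding N_def r_def by (rule norm_cauchy_schwarz)
  have 3: "(norm (y - w))\<^sup>2 - (norm (y - v))\<^sup>2 \<le> 2 * D * r"
  proof -
    have "(norm (y - w))\<^sup>2 - (norm (y - v))\<^sup>2 = (norm (y - w) - norm (y - v)) * (norm (y - w) + norm (y - v))"
      by (simp add: power2_eq_square algebra_simps)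
    also have "\<dots> \<le> r * (norm (y - w) + norm (y - v))"
      using norm_triangle_ineq2[of "y - w" "y - v"] by (intro mult_right_mono) (auto simp: r_def)
    also have "r * (norm (y - w) + norm (y - v)) \<le> r * (2 * D)" using r D by (intro mult_left_mono) auto
    finally show ?thesis by (simp add: mult_ac)
  qed
  have 4: "(v - w) \<bullet> p \<le> \<beta> * D * r + \<beta> / 2 * (diameter S)\<^sup>2"
  proof -
    have "(v - w) \<bullet> p \<le> \<beta> / 2 * ((norm (y - w))\<^sup>2 - (norm (y - v))\<^sup>2) + \<beta> / 2 * (diameter S)\<^sup>2"
      using nearest_extreme_point_le(2)[OF arg y w(1)] \<beta>_pos by (simp add: inner_diff algebra_simps)
    also have "\<beta> / 2 * ((norm (y - w))\<^sup>2 - (norm (y - v))\<^sup>2) \<le> \<beta> / 2 * (2 * D * r)"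
      using 3 \<beta>_pos by (intro mult_left_mono) auto
    finally show ?thesis by simp
  qed
  \<comment> \<open>With these weights two applications cost \<open>\<alpha> / 4 * r\<^sup>2\<close>
    in total, which by quadratic growth is at most half of \<open>gap v\<close> and can be absorbed
    on the left.\<close>
  have amgm: "2 * a * b \<le> \<alpha> / 8 * b\<^sup>2 + 8 / \<alpha> * a\<^sup>2" for a b
  proof -
    have "0 \<le> (\<alpha> * b - 8 * a)\<^sup>2 / (8 * \<alpha>)" using \<alpha>_pos by simp
    also have "\<dots> = \<alpha> / 8 * b\<^sup>2 + 8 / \<alpha> * a\<^sup>2 - 2 * a * b"
      using \<alpha>_pos by (simp add: power2_eq_square field_simps)
    finally show ?thesis by simp
  qed
  have "gap v \<le> f' v \<bullet> (v - w)" by (rule gap_le_gradient[OF v w(1)])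
  also have "\<dots> = (f' v - f' y) \<bullet> (v - w) + (f' y - p) \<bullet> (v - w) + (v - w) \<bullet> p"
    by (simp add: inner_diff inner_commute)
  also have "\<dots> \<le> 2 * (\<beta> * D) * r + 2 * (N / 2) * r + \<beta> / 2 * (diameter S)\<^sup>2"
    using 1 2 4 by simp
  finally have "gap v \<le> \<alpha> / 4 * r\<^sup>2 + 8 / \<alpha> * (\<beta> * D)\<^sup>2 + 8 / \<alpha> * (N / 2)\<^sup>2 + \<beta> / 2 * (diameter S)\<^sup>2"
    using amgm[of "\<beta> * D" r] amgm[of "N / 2" r] by linarith
  moreover have "\<alpha> / 4 * r\<^sup>2 \<le> gap v / 2" using w(3) \<alpha>_pos by (simp add: r_def field_simps)
  ultimately have "gap v \<le> 2 * (8 / \<alpha> * (\<beta> * D)\<^sup>2) + 2 * (8 / \<alpha> * (N / 2)\<^sup>2) + 2 * (\<beta> / 2 * (diameter S)\<^sup>2)"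
    by argo
  then show ?thesis by (simp add: D_def N_def power_mult_distrib power_divide)
qed

end

section \<open>Variance of the averaged gradient\<close>

text \<open>The hypothesis on sets says that two measures coincide: the image under \<open>X\<close>
  of the density \<open>\<Phi>\<close>, and the mixture of the kernel \<open>\<kappa>\<close> over
  the density \<open>\<Psi>\<close>. Equal measures give equal integrals of every nonnegative
  \<open>u\<close>.\<close>

lemma nn_integral_kernel_extend:
  fixes \<Phi> \<Psi> :: "'w \<Rightarrow> ennreal"
  assumes [measurable]: "\<Phi> \<in> borel_measurable M" "\<Psi> \<in> borel_measurable M"
    and X[measurable]: "X \<in> M \<rightarrow>\<^sub>M N" and \<kappa>[measurable]: "\<kappa> \<in> M \<rightarrow>\<^sub>M subprob_algebra N"
    and ne: "space M \<noteq> {}"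
    and eq: "\<And>B. B \<in> sets N \<Longrightarrow>
      (\<integral>\<^sup>+\<omega>. \<Phi> \<omega> * indicator B (X \<omega>) \<partial>M) = (\<integral>\<^sup>+\<omega>. \<Psi> \<omega> * emeasure (\<kappa> \<omega>) B \<partial>M)"
    and [measurable]: "u \<in> borel_measurable N"
  shows "(\<integral>\<^sup>+\<omega>. \<Phi> \<omega> * u (X \<omega>) \<partial>M) = (\<integral>\<^sup>+\<omega>. \<Psi> \<omega> * (\<integral>\<^sup>+y. u y \<partial>\<kappa> \<omega>) \<partial>M)"
proof -
  have \<kappa>': "\<kappa> \<in> density M \<Psi> \<rightarrow>\<^sub>M subprob_algebra N" by simp
  have "distr (density M \<Phi>) N X = density M \<Psi> \<bind> \<kappa>"
  proof (rule measure_eqI)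
    show sets: "sets (distr (density M \<Phi>) N X) = sets (density M \<Psi> \<bind> \<kappa>)"
      using sets_bind[OF sets_kernel[OF \<kappa>'], of "density M \<Psi>"] ne by simp
    fix B assume "B \<in> sets (distr (density M \<Phi>) N X)"
    then have B[measurable]: "B \<in> sets N" by simp
    have "emeasure (distr (density M \<Phi>) N X) B = (\<integral>\<^sup>+\<omega>. \<Phi> \<omega> * indicator B (X \<omega>) \<partial>M)"
      by (subst emeasure_distr) (auto simp: emeasure_density indicator_def intro!: nn_integral_cong)
    also have "\<dots> = emeasure (density M \<Psi> \<bind> \<kappa>) B"
      using eq[OF B] emeasure_bind[OF _ \<kappa>' B] ne by (simp add: nn_integral_density)
    finally show "emeasure (distr (density M \<Phi>) N X) B = emeasure (density M \<Psi> \<bind> \<kappa>) B" .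
  qed
  then have "(\<integral>\<^sup>+y. u y \<partial>distr (density M \<Phi>) N X) = (\<integral>\<^sup>+y. u y \<partial>(density M \<Psi> \<bind> \<kappa>))"
    by simp
  moreover have "(\<integral>\<^sup>+y. u y \<partial>distr (density M \<Phi>) N X) = (\<integral>\<^sup>+\<omega>. \<Phi> \<omega> * u (X \<omega>) \<partial>M)"
    by (simp add: nn_integral_distr nn_integral_density)
  moreover have "(\<integral>\<^sup>+y. u y \<partial>(density M \<Psi> \<bind> \<kappa>)) = (\<integral>\<^sup>+\<omega>. \<Psi> \<omega> * (\<integral>\<^sup>+y. u y \<partial>\<kappa> \<omega>) \<partial>M)"
    by (subst nn_integral_bind[OF _ \<kappa>'])
      (auto simp: nn_integral_density nn_integral_measurable_subprob_algebra)
  ultimately show ?thesis by simp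
qed

section \<open>The random run: feasibility and measurability\<close>

locale stochastic_nep_problem =
  smooth_convex_problem K f f' \<alpha> \<beta> S + stochastic_nep_frank_wolfe M F K Orc \<beta> \<eta> m x v g
  for K :: "'a::euclidean_space set" and f f' \<alpha> \<beta> S and M :: "'w measure" and F Orc \<eta> m x v g +
  fixes G :: real
  assumes gradient_oracle: "stochastic_gradient_oracle K f' G Orc"
    and step_size: "1 \<le> t \<Longrightarrow> 0 \<le> \<eta> t \<and> \<eta> t \<le> 1"
    and batch_pos: "1 \<le> t \<Longrightarrow> 1 \<le> m t"
begin

lemma x_in_K: "1 \<le> t \<Longrightarrow> \<omega> \<in> space M \<Longrightarrow> x t \<omega> \<in> K"
proof (induction t rule: nat_induct_at_least)
  case base
  then show ?case using init by (simp add: extreme_point_of_def)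
next
  case (Suc t)
  then have "v t \<omega> \<in> K" using nep_step[of t \<omega>] by (simp add: is_arg_min_linorder extreme_point_of_def)
  then show ?case using Suc x_step[of t \<omega>] convex_K step_size[of t] by (simp add: convexD)
qed

lemma measurable_F_M: "X \<in> F t \<rightarrow>\<^sub>M N \<Longrightarrow> X \<in> M \<rightarrow>\<^sub>M N"
  using subalgebra_F measurable_from_subalg by blast

lemma x_measurable: "1 \<le> t \<Longrightarrow> x t \<in> F t \<rightarrow>\<^sub>M restrict_space borel K"
  using x_adapted x_in_K space_F by (intro measurable_restrict_space2) auto

lemma Orc_measurable: "1 \<le> t \<Longrightarrow> (\<lambda>\<omega>. Orc (x t \<omega>)) \<in> M \<rightarrow>\<^sub>M prob_algebra borel"
  using gradient_oracle measurable_compose[OF measurable_F_M[OF x_measurable]]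
  unfolding stochastic_gradient_oracle_def by blast

lemma g_measurable: "1 \<le> t \<Longrightarrow> i < m t \<Longrightarrow> g t i \<in> borel_measurable M"
  using g_adapted measurable_F_M by blast

lemma Orc_prob_space: "1 \<le> t \<Longrightarrow> \<omega> \<in> space M \<Longrightarrow> prob_space (Orc (x t \<omega>))"
  using measurable_space[OF Orc_measurable] by (auto simp: space_prob_algebra)

lemma Orc_sets: "1 \<le> t \<Longrightarrow> \<omega> \<in> space M \<Longrightarrow> sets (Orc (x t \<omega>)) = sets borel"
  using measurable_space[OF Orc_measurable] by (auto simp: space_prob_algebra)

lemma Orc_subprob: "1 \<le> t \<Longrightarrow> (\<lambda>\<omega>. Orc (x t \<omega>)) \<in> M \<rightarrow>\<^sub>M subprob_algebra borel"
  by (intro measurable_prob_algebraD Orc_measurable)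

section \<open>Integrals of functions of fresh samples\<close>

lemma Orc_nn_integral_measurable:
  "1 \<le> t \<Longrightarrow> u \<in> borel_measurable borel \<Longrightarrow> (\<lambda>\<omega>. \<integral>\<^sup>+y. u y \<partial>Orc (x t \<omega>)) \<in> borel_measurable M"
  by (rule measurable_compose[OF Orc_subprob nn_integral_measurable_subprob_algebra])

text \<open>Nonnegative integrals need no integrability and can be extended to arbitrary nonnegative
  functions, so \<open>fresh_samples\<close> is carried over to them. All factors lie between 0 and
  1, so the two kinds of integral agree.\<close>

lemma fresh_samples_indicator:
  assumes t: "1 \<le> t" and A: "A \<in> sets (F t)" and B: "\<And>i. i < m t \<Longrightarrow> B i \<in> sets borel"
  shows "(\<integral>\<^sup>+\<omega>. indicator A \<omega> * (\<Prod>i<m t. indicator (B i) (g t i \<omega>)) \<partial>M) =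
    (\<integral>\<^sup>+\<omega>. indicator A \<omega> * (\<Prod>i<m t. emeasure (Orc (x t \<omega>)) (B i)) \<partial>M)"
proof -
  let ?E = "A \<inter> {\<omega> \<in> space M. \<forall>i<m t. g t i \<omega> \<in> B i}"
  let ?p = "\<lambda>\<omega>. indicator A \<omega> * (\<Prod>i<m t. measure (Orc (x t \<omega>)) (B i)) :: real"
  have A': "A \<in> sets M" using A subalgebra_F[of t] by (auto simp: subalgebra_def)
  have E: "?E \<in> sets M"
  proof -
    have "{\<omega> \<in> space M. \<forall>i\<in>{..<m t}. g t i \<omega> \<in> B i} \<in> sets M"
    proof (rule sets.sets_Collect_finite_All)
      fix i assume "i \<in> {..<m t}"
      then have "g t i -` B i \<inter> space M \<in> sets M"
        using B by (intro measurable_sets[OF g_measurable[OF t]]) auto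
      then show "{\<omega> \<in> space M. g t i \<omega> \<in> B i} \<in> sets M" unfolding vimage_def Int_def mem_Collect_eq conj_commute[of "_ \<in> space M"] .
    qed simp
    then have "{\<omega> \<in> space M. \<forall>i<m t. g t i \<omega> \<in> B i} \<in> sets M" unfolding Ball_def lessThan_iff .
    with A' show ?thesis by (rule sets.Int)
  qed
  have meas: "(\<lambda>\<omega>. measure (Orc (x t \<omega>)) (B i)) \<in> borel_measurable M" if "i < m t" for i
    by (rule measurable_compose[OF Orc_subprob[OF t] measurable_measure_subprob_algebra[OF B[OF that]]])
  have p1: "0 \<le> ?p \<omega>" "?p \<omega> \<le> 1" if "\<omega> \<in> space M" for \<omega>
    using prob_space.prob_le_1[OF Orc_prob_space[OF t that]]
    by (auto intro!: mult_le_one prod_le_1 prod_nonneg simp: indicator_def)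
  have pm: "?p \<in> borel_measurable M" using A' meas by (intro borel_measurable_times borel_measurable_prod borel_measurable_indicator) auto
  have "(\<integral>\<^sup>+\<omega>. indicator A \<omega> * (\<Prod>i<m t. indicator (B i) (g t i \<omega>)) \<partial>M) = (\<integral>\<^sup>+\<omega>. indicator ?E \<omega> \<partial>M)"
    by (intro nn_integral_cong) (auto simp: indicator_def prod_zero_iff)
  also have "\<dots> = ennreal (prob ?E)" using E by (simp add: emeasure_eq_measure)
  also have "\<dots> = ennreal (\<integral>\<omega>. ?p \<omega> \<partial>M)" using fresh_samples[OF t A B] by simp
  also have "\<dots> = (\<integral>\<^sup>+\<omega>. ennreal (?p \<omega>) \<partial>M)"
    using p1 pm by (intro nn_integral_eq_integral[symmetric] integrable_const_bound[where B=1]) auto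
  also have "\<dots> = (\<integral>\<^sup>+\<omega>. indicator A \<omega> * (\<Prod>i<m t. emeasure (Orc (x t \<omega>)) (B i)) \<partial>M)"
  proof (rule nn_integral_cong)
    fix \<omega> assume "\<omega> \<in> space M"
    then interpret o: prob_space "Orc (x t \<omega>)" by (rule Orc_prob_space[OF t])
    show "ennreal (?p \<omega>) = indicator A \<omega> * (\<Prod>i<m t. emeasure (Orc (x t \<omega>)) (B i))"
      by (simp add: o.emeasure_eq_measure prod_ennreal ennreal_mult' ennreal_indicator prod_nonneg)
  qed
  finally show ?thesis .
qed

text \<open>The indicators in \<open>fresh_samples\<close> are replaced by nonnegative functions one sample at a time;
  \<open>J\<close> collects the samples already treated.\<close>

lemma fresh_samples_nn_integral_aux:
  assumes "finite J" and t: "1 \<le> t" and A: "A \<in> sets (F t)"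
    and "\<And>i. i < m t \<Longrightarrow> \<phi> i \<in> borel_measurable borel"
    and "\<And>i. i < m t \<Longrightarrow> i \<notin> J \<Longrightarrow> \<exists>B\<in>sets borel. \<phi> i = indicator B"
  shows "(\<integral>\<^sup>+\<omega>. indicator A \<omega> * (\<Prod>i<m t. \<phi> i (g t i \<omega>)) \<partial>M) =
    (\<integral>\<^sup>+\<omega>. indicator A \<omega> * (\<Prod>i<m t. \<integral>\<^sup>+y. \<phi> i y \<partial>Orc (x t \<omega>)) \<partial>M)"
  using assms(1,4,5)
proof (induction J arbitrary: \<phi>)
  case empty
  then have "\<forall>i\<in>{..<m t}. \<exists>B. B \<in> sets borel \<and> \<phi> i = indicator B" by auto
  from bchoice[OF this] obtain B where B: "\<And>i. i < m t \<Longrightarrow> B i \<in> sets borel \<and> \<phi> i = indicator (B i)"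
    by auto
  have "(\<integral>\<^sup>+\<omega>. indicator A \<omega> * (\<Prod>i<m t. \<phi> i (g t i \<omega>)) \<partial>M) =
      (\<integral>\<^sup>+\<omega>. indicator A \<omega> * (\<Prod>i<m t. indicator (B i) (g t i \<omega>)) \<partial>M)"
    using B by (intro nn_integral_cong arg_cong2[where f="(*)"] refl prod.cong) auto
  also have "\<dots> = (\<integral>\<^sup>+\<omega>. indicator A \<omega> * (\<Prod>i<m t. emeasure (Orc (x t \<omega>)) (B i)) \<partial>M)"
    using B by (intro fresh_samples_indicator[OF t A]) auto
  also have "\<dots> = (\<integral>\<^sup>+\<omega>. indicator A \<omega> * (\<Prod>i<m t. \<integral>\<^sup>+y. \<phi> i y \<partial>Orc (x t \<omega>)) \<partial>M)"
    using B Orc_sets[OF t] by (intro nn_integral_cong arg_cong2[where f="(*)"] refl prod.cong) auto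
  finally show ?case .
next
  case (insert j J)
  show ?case
  proof (cases "j < m t")
    case False
    then show ?thesis using insert by (intro insert.IH) auto
  next
    case j: True
    let ?R = "{..<m t} - {j}"
    let ?\<Phi> = "\<lambda>\<omega>. indicator A \<omega> * (\<Prod>i\<in>?R. \<phi> i (g t i \<omega>))"
    let ?\<Psi> = "\<lambda>\<omega>. indicator A \<omega> * (\<Prod>i\<in>?R. \<integral>\<^sup>+y. \<phi> i y \<partial>Orc (x t \<omega>))"
    have A': "A \<in> sets M" using A subalgebra_F[of t] by (auto simp: subalgebra_def)
    have split: "(\<Prod>i<m t. h i) = (\<Prod>i\<in>?R. h i) * h j" for h :: "nat \<Rightarrow> ennreal"
      using j by (simp add: prod.remove[of _ j] mult.commute)
    have "(\<integral>\<^sup>+\<omega>. ?\<Phi> \<omega> * \<phi> j (g t j \<omega>) \<partial>M) = (\<integral>\<^sup>+\<omega>. ?\<Psi> \<omega> * (\<integral>\<^sup>+y. \<phi> j y \<partial>Orc (x t \<omega>)) \<partial>M)"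
    proof (rule nn_integral_kernel_extend)
      show "?\<Phi> \<in> borel_measurable M"
        using A' insert.prems(1)
        by (intro borel_measurable_times_ennreal borel_measurable_prod_ennreal
            measurable_compose[OF g_measurable[OF t]]) auto
      show "?\<Psi> \<in> borel_measurable M"
        using A' insert.prems(1)
        by (intro borel_measurable_times_ennreal borel_measurable_prod_ennreal
            Orc_nn_integral_measurable[OF t]) auto
      show "g t j \<in> M \<rightarrow>\<^sub>M borel" using g_measurable[OF t j] .
      show "(\<lambda>\<omega>. Orc (x t \<omega>)) \<in> M \<rightarrow>\<^sub>M subprob_algebra borel" using Orc_subprob[OF t] .
      show "space M \<noteq> {}" by (rule not_empty)
      show "\<phi> j \<in> borel_measurable borel" using insert.prems j by blast
      \<comment> \<open>The induction hypothesis with \<open>indicator B\<close> in place of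
        \<open>\<phi> j\<close> is the set-wise identity that the kernel lemma asks for; the other
        factors are frozen in \<open>?\<Phi>\<close> and \<open>?\<Psi>\<close>.\<close>
      fix B :: "'a set" assume B: "B \<in> sets borel"
      have "(\<integral>\<^sup>+\<omega>. indicator A \<omega> * (\<Prod>i<m t. (\<phi>(j := indicator B)) i (g t i \<omega>)) \<partial>M) =
        (\<integral>\<^sup>+\<omega>. indicator A \<omega> * (\<Prod>i<m t. \<integral>\<^sup>+y. (\<phi>(j := indicator B)) i y \<partial>Orc (x t \<omega>)) \<partial>M)"
        using insert.prems B by (intro insert.IH) auto
      then show "(\<integral>\<^sup>+\<omega>. ?\<Phi> \<omega> * indicator B (g t j \<omega>) \<partial>M) =
          (\<integral>\<^sup>+\<omega>. ?\<Psi> \<omega> * emeasure (Orc (x t \<omega>)) B \<partial>M)"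
        using B Orc_sets[OF t] unfolding split
        by (simp add: mult.assoc cong: nn_integral_cong_simp)
    qed
    then show ?thesis unfolding split by (simp add: mult.assoc)
  qed
qed

text \<open>Events of \<open>F t\<close> are replaced by measurable weights through the kernel lemma
  once more, now with the identity into \<open>F t\<close> as the map and the Dirac kernel
  \<open>return (F t)\<close>; the products over the samples are the densities.\<close>

lemma fresh_samples_nn_integral:
  assumes t: "1 \<le> t" and Z: "Z \<in> borel_measurable (F t)"
    and \<phi>: "\<And>i. i < m t \<Longrightarrow> \<phi> i \<in> borel_measurable borel"
  shows "(\<integral>\<^sup>+\<omega>. Z \<omega> * (\<Prod>i<m t. \<phi> i (g t i \<omega>)) \<partial>M) =
    (\<integral>\<^sup>+\<omega>. Z \<omega> * (\<Prod>i<m t. \<integral>\<^sup>+y. \<phi> i y \<partial>Orc (x t \<omega>)) \<partial>M)"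
proof -
  let ?\<Phi> = "\<lambda>\<omega>. \<Prod>i<m t. \<phi> i (g t i \<omega>)"
  let ?\<Psi> = "\<lambda>\<omega>. \<Prod>i<m t. \<integral>\<^sup>+y. \<phi> i y \<partial>Orc (x t \<omega>)"
  have id: "(\<lambda>\<omega>. \<omega>) \<in> M \<rightarrow>\<^sub>M F t" by (rule measurable_F_M[of _ t]) simp
  have ret: "return (F t) \<in> M \<rightarrow>\<^sub>M subprob_algebra (F t)"
    by (rule measurable_F_M[OF return_measurable])
  have "(\<integral>\<^sup>+\<omega>. ?\<Phi> \<omega> * Z \<omega> \<partial>M) = (\<integral>\<^sup>+\<omega>. ?\<Psi> \<omega> * (\<integral>\<^sup>+y. Z y \<partial>return (F t) \<omega>) \<partial>M)"
  proof (rule nn_integral_kernel_extend[OF _ _ id ret not_empty _ Z])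
    show "?\<Phi> \<in> borel_measurable M"
      using \<phi> by (intro borel_measurable_prod_ennreal measurable_compose[OF g_measurable[OF t]]) auto
    show "?\<Psi> \<in> borel_measurable M"
      using \<phi> by (intro borel_measurable_prod_ennreal Orc_nn_integral_measurable[OF t]) auto
    fix A assume "A \<in> sets (F t)"
    then show "(\<integral>\<^sup>+\<omega>. ?\<Phi> \<omega> * indicator A \<omega> \<partial>M) =
        (\<integral>\<^sup>+\<omega>. ?\<Psi> \<omega> * emeasure (return (F t) \<omega>) A \<partial>M)"
      using fresh_samples_nn_integral_aux[of "{..<m t}", OF _ t _ \<phi>]
      by (simp add: mult.commute)
  qed
  also have "\<dots> = (\<integral>\<^sup>+\<omega>. ?\<Psi> \<omega> * Z \<omega> \<partial>M)"
    using Z space_F by (intro nn_integral_cong) (simp add: nn_integral_return)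
  finally show ?thesis by (simp add: mult.commute)
qed

text \<open>The conditional law of one sample given \<open>F t\<close>: every factor but the
  \<open>i\<close>-th is set to 1, and a probability law integrates 1 to 1.\<close>

lemma fresh_sample_nn_integral:
  assumes t: "1 \<le> t" and i: "i < m t" and Z: "Z \<in> borel_measurable (F t)"
    and p: "p \<in> borel_measurable borel"
  shows "(\<integral>\<^sup>+\<omega>. Z \<omega> * p (g t i \<omega>) \<partial>M) = (\<integral>\<^sup>+\<omega>. Z \<omega> * (\<integral>\<^sup>+y. p y \<partial>Orc (x t \<omega>)) \<partial>M)"
proof -
  let ?\<phi> = "\<lambda>k y. if k = i then p y else 1"
  have one: "(\<integral>\<^sup>+y. 1 \<partial>Orc (x t \<omega>)) = 1" if "\<omega> \<in> space M" for \<omega>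
    using prob_space.emeasure_space_1[OF Orc_prob_space[OF t that]] by simp
  have "(\<integral>\<^sup>+\<omega>. Z \<omega> * p (g t i \<omega>) \<partial>M) = (\<integral>\<^sup>+\<omega>. Z \<omega> * (\<Prod>k<m t. ?\<phi> k (g t k \<omega>)) \<partial>M)"
    using i by (intro nn_integral_cong) (simp add: prod.delta)
  also have "\<dots> = (\<integral>\<^sup>+\<omega>. Z \<omega> * (\<Prod>k<m t. \<integral>\<^sup>+y. ?\<phi> k y \<partial>Orc (x t \<omega>)) \<partial>M)"
    using p by (intro fresh_samples_nn_integral[OF t Z]) auto
  also have "\<dots> = (\<integral>\<^sup>+\<omega>. Z \<omega> * (\<integral>\<^sup>+y. p y \<partial>Orc (x t \<omega>)) \<partial>M)"
  proof (intro nn_integral_cong arg_cong2[where f="(*)"] refl)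
    fix \<omega> assume "\<omega> \<in> space M"
    then have "(\<integral>\<^sup>+y. ?\<phi> k y \<partial>Orc (x t \<omega>)) = (if k = i then \<integral>\<^sup>+y. p y \<partial>Orc (x t \<omega>) else 1)" for k
      using one by auto
    then show "(\<Prod>k<m t. \<integral>\<^sup>+y. ?\<phi> k y \<partial>Orc (x t \<omega>)) = (\<integral>\<^sup>+y. p y \<partial>Orc (x t \<omega>))"
      using i by (simp add: prod.delta)
  qed
  finally show ?thesis .
qed

text \<open>Conditional independence of two samples, integrated: only the factors \<open>i\<close>
  and \<open>j\<close> differ from 1, and \<open>i \<noteq> j\<close> keeps them apart.\<close>

lemma fresh_sample_pair_nn_integral:
  assumes t: "1 \<le> t" and ij: "i < m t" "j < m t" "i \<noteq> j"
    and p: "p \<in> borel_measurable borel" and q: "q \<in> borel_measurable borel"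
  shows "(\<integral>\<^sup>+\<omega>. p (g t i \<omega>) * q (g t j \<omega>) \<partial>M) =
    (\<integral>\<^sup>+\<omega>. (\<integral>\<^sup>+y. p y \<partial>Orc (x t \<omega>)) * (\<integral>\<^sup>+y. q y \<partial>Orc (x t \<omega>)) \<partial>M)"
proof -
  let ?\<phi> = "\<lambda>k y. (if k = i then p y else 1) * (if k = j then q y else 1)"
  have one: "(\<integral>\<^sup>+y. 1 \<partial>Orc (x t \<omega>)) = 1" if "\<omega> \<in> space M" for \<omega>
    using prob_space.emeasure_space_1[OF Orc_prob_space[OF t that]] by simp
  have "(\<integral>\<^sup>+\<omega>. p (g t i \<omega>) * q (g t j \<omega>) \<partial>M) = (\<integral>\<^sup>+\<omega>. 1 * (\<Prod>k<m t. ?\<phi> k (g t k \<omega>)) \<partial>M)"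
    using ij by (intro nn_integral_cong) (simp add: prod.delta prod.distrib)
  also have "\<dots> = (\<integral>\<^sup>+\<omega>. 1 * (\<Prod>k<m t. \<integral>\<^sup>+y. ?\<phi> k y \<partial>Orc (x t \<omega>)) \<partial>M)"
    using p q by (intro fresh_samples_nn_integral[OF t]) auto
  also have "\<dots> = (\<integral>\<^sup>+\<omega>. (\<integral>\<^sup>+y. p y \<partial>Orc (x t \<omega>)) * (\<integral>\<^sup>+y. q y \<partial>Orc (x t \<omega>)) \<partial>M)"
  proof (intro nn_integral_cong)
    fix \<omega> assume "\<omega> \<in> space M"
    then have "(\<integral>\<^sup>+y. ?\<phi> k y \<partial>Orc (x t \<omega>)) = (if k = i then \<integral>\<^sup>+y. p y \<partial>Orc (x t \<omega>) else 1)
        * (if k = j then \<integral>\<^sup>+y. q y \<partial>Orc (x t \<omega>) else 1)" for k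
      using one ij by auto
    then show "1 * (\<Prod>k<m t. \<integral>\<^sup>+y. ?\<phi> k y \<partial>Orc (x t \<omega>)) =
        (\<integral>\<^sup>+y. p y \<partial>Orc (x t \<omega>)) * (\<integral>\<^sup>+y. q y \<partial>Orc (x t \<omega>))"
      using ij by (simp add: prod.delta prod.distrib)
  qed
  finally show ?thesis .
qed

section \<open>Almost sure bounds by \<open>G\<close>\<close>

lemma oracle_bounded: "y \<in> K \<Longrightarrow> AE h in Orc y. norm h \<le> G"
  and oracle_unbiased: "y \<in> K \<Longrightarrow> has_bochner_integral (Orc y) (\<lambda>h. h) (f' y)"
  using gradient_oracle unfolding stochastic_gradient_oracle_def by auto

text \<open>The gradient is the mean of an answer of norm at most \<open>G\<close>.\<close>

lemma norm_gradient_le: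
  assumes "y \<in> K" shows "norm (f' y) \<le> G"
proof -
  have "Orc \<in> restrict_space borel K \<rightarrow>\<^sub>M prob_algebra borel"
    using gradient_oracle unfolding stochastic_gradient_oracle_def by blast
  from measurable_space[OF this, of y] assms interpret o: prob_space "Orc y"
    by (auto simp: space_prob_algebra space_restrict_space)
  have int: "integrable (Orc y) (\<lambda>h. h)" and eq: "(\<integral>h. h \<partial>Orc y) = f' y"
    using oracle_unbiased[OF assms] by (auto simp: has_bochner_integral_iff)
  have "norm (f' y) \<le> (\<integral>h. norm h \<partial>Orc y)" unfolding eq[symmetric] by (rule integral_norm_bound)
  also have "\<dots> \<le> (\<integral>h. G \<partial>Orc y)"
    using oracle_bounded[OF assms] int by (intro integral_mono_AE) auto
  finally show ?thesis by (simp add: o.prob_space)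
qed

lemma G_nonneg: "0 \<le> G"
  using norm_gradient_le K_nonempty norm_ge_zero order_trans by blast

text \<open>The event of exceeding \<open>G\<close> has mass zero under every law
  \<open>Orc (x t \<omega>)\<close>, hence, after integration over the run, also for the sample
  itself.\<close>

lemma AE_norm_sample_le:
  assumes t: "1 \<le> t" and i: "i < m t"
  shows "AE \<omega> in M. norm (g t i \<omega>) \<le> G"
proof -
  let ?B = "{h :: 'a. \<not> norm h \<le> G}"
  have B: "?B \<in> sets borel" by measurable
  have "(\<integral>\<^sup>+\<omega>. 1 * indicator ?B (g t i \<omega>) \<partial>M) =
      (\<integral>\<^sup>+\<omega>. 1 * (\<integral>\<^sup>+y. indicator ?B y \<partial>Orc (x t \<omega>)) \<partial>M)"
    using B by (intro fresh_sample_nn_integral[OF t i]) auto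
  also have "\<dots> = (\<integral>\<^sup>+\<omega>. 0 \<partial>M)"
  proof (rule nn_integral_cong)
    fix \<omega> assume \<omega>: "\<omega> \<in> space M"
    have "(\<integral>\<^sup>+y. indicator ?B y \<partial>Orc (x t \<omega>)) = (\<integral>\<^sup>+y. 0 \<partial>Orc (x t \<omega>))"
      using oracle_bounded[OF x_in_K[OF t \<omega>]]
      by (intro nn_integral_cong_AE) (auto simp: indicator_def)
    then show "1 * (\<integral>\<^sup>+y. indicator ?B y \<partial>Orc (x t \<omega>)) = 0" by simp
  qed
  finally have "(\<integral>\<^sup>+\<omega>. indicator ?B (g t i \<omega>) \<partial>M) = 0" by simp
  then have "AE \<omega> in M. indicator ?B (g t i \<omega>) = (0 :: ennreal)"
    using measurable_compose[OF g_measurable[OF t i] borel_measurable_indicator[OF B, where ?'b = ennreal]]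
    by (subst (asm) nn_integral_0_iff_AE) auto
  then show ?thesis by (rule AE_mp) (auto simp: indicator_def split: if_splits)
qed

lemma gradient_adapted: "1 \<le> t \<Longrightarrow> (\<lambda>\<omega>. f' (x t \<omega>)) \<in> borel_measurable (F t)"
  by (rule measurable_compose[OF x_measurable borel_measurable_continuous_on_restrict[OF continuous_f']])

section \<open>Moments of the sample noise\<close>

definition noise :: "nat \<Rightarrow> nat \<Rightarrow> 'w \<Rightarrow> 'a" where
  "noise t i \<omega> = g t i \<omega> - f' (x t \<omega>)"

lemma noise_measurable:
  "1 \<le> t \<Longrightarrow> i < m t \<Longrightarrow> noise t i \<in> borel_measurable M"
  unfolding noise_def using g_measurable measurable_F_M[OF gradient_adapted] by simp

lemma AE_norm_noise_le:
  assumes t: "1 \<le> t" and i: "i < m t"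
  shows "AE \<omega> in M. norm (noise t i \<omega>) \<le> 2 * G"
  using AE_norm_sample_le[OF assms] AE_space
proof eventually_elim
  case (elim \<omega>)
  then show ?case
    using norm_triangle_ineq4[of "g t i \<omega>" "f' (x t \<omega>)"] norm_gradient_le[OF x_in_K[OF t, of \<omega>]]
    by (simp add: noise_def)
qed

text \<open>The shift by \<open>G\<close> makes the coordinates nonnegative, so that the identities for nonnegative
  integrals apply to them.\<close>

lemma nn_integral_oracle_inner:
  assumes t: "1 \<le> t" and \<omega>: "\<omega> \<in> space M" and b: "b \<in> Basis"
  shows "(\<integral>\<^sup>+y. ennreal (y \<bullet> b + G) \<partial>Orc (x t \<omega>)) = ennreal (f' (x t \<omega>) \<bullet> b + G)"
proof -
  interpret o: prob_space "Orc (x t \<omega>)" by (rule Orc_prob_space[OF t \<omega>])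
  have xK: "x t \<omega> \<in> K" by (rule x_in_K[OF t \<omega>])
  have "has_bochner_integral (Orc (x t \<omega>)) (\<lambda>y. y \<bullet> b + G) (f' (x t \<omega>) \<bullet> b + G)"
    using has_bochner_integral_inner_left[OF oracle_unbiased[OF xK], of b]
    by (simp add: o.prob_space has_bochner_integral_iff)
  moreover have "AE y in Orc (x t \<omega>). 0 \<le> y \<bullet> b + G"
    using oracle_bounded[OF xK]
  proof eventually_elim
    case (elim y)
    then show ?case using Basis_le_norm[OF b, of y] by simp
  qed
  ultimately show ?thesis
    by (simp add: has_bochner_integral_iff nn_integral_eq_integral)
qed

lemma integrable_AE_bounded:
  fixes X :: "'w \<Rightarrow> real"
  assumes "X \<in> borel_measurable M" "AE \<omega> in M. \<bar>X \<omega>\<bar> \<le> B"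
  shows "integrable M X"
  using assms by (intro integrable_const_bound[where B=B]) auto

lemma abs_inner_Basis_le: "b \<in> Basis \<Longrightarrow> norm y \<le> C \<Longrightarrow> \<bar>y \<bullet> b\<bar> \<le> C"
  using Basis_le_norm order_trans by blast

text \<open>A sample has conditional mean \<open>f' (x t \<omega>)\<close>, so its noise is
  orthogonal to every weight \<open>W\<close> known before the iteration. The shifted parts
  \<open>?a\<close> and \<open>?c\<close> are almost surely nonnegative, so their nonnegative
  integrals can be compared and then subtracted.\<close>

lemma expectation_noise_mult:
  assumes t: "1 \<le> t" and i: "i < m t" and b: "b \<in> Basis"
    and W: "W \<in> borel_measurable (F t)" "\<And>\<omega>. \<omega> \<in> space M \<Longrightarrow> 0 \<le> W \<omega> \<and> W \<omega> \<le> C"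
  shows "integrable M (\<lambda>\<omega>. W \<omega> * (noise t i \<omega> \<bullet> b))"
    and "(\<integral>\<omega>. W \<omega> * (noise t i \<omega> \<bullet> b) \<partial>M) = 0"
proof -
  let ?a = "\<lambda>\<omega>. W \<omega> * (g t i \<omega> \<bullet> b + G)" and ?c = "\<lambda>\<omega>. W \<omega> * (f' (x t \<omega>) \<bullet> b + G)"
  have meas: "?a \<in> borel_measurable M" "?c \<in> borel_measurable M"
    using measurable_F_M[OF W(1)] g_measurable[OF t i] measurable_F_M[OF gradient_adapted[OF t]] by auto
  have a: "AE \<omega> in M. 0 \<le> ?a \<omega> \<and> ?a \<omega> \<le> C * (2 * G)"
    using AE_norm_sample_le[OF t i] AE_space
  proof eventually_elim
    case (elim \<omega>)
    then have "\<bar>g t i \<omega> \<bullet> b\<bar> \<le> G" by (intro abs_inner_Basis_le[OF b])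
    with W(2)[OF elim(2)] show ?case by (intro conjI mult_nonneg_nonneg mult_mono) auto
  qed
  have c: "0 \<le> ?c \<omega> \<and> ?c \<omega> \<le> C * (2 * G)" if "\<omega> \<in> space M" for \<omega>
  proof -
    have "\<bar>f' (x t \<omega>) \<bullet> b\<bar> \<le> G"
      by (intro abs_inner_Basis_le[OF b] norm_gradient_le x_in_K[OF t that])
    with W(2)[OF that] show ?thesis by (intro conjI mult_nonneg_nonneg mult_mono) auto
  qed
  have int: "integrable M ?a" "integrable M ?c"
    using meas a c by (auto intro!: integrable_AE_bounded[where B="C * (2 * G)"])
  have eq: "(\<lambda>\<omega>. W \<omega> * (noise t i \<omega> \<bullet> b)) = (\<lambda>\<omega>. ?a \<omega> - ?c \<omega>)"
    by (simp add: noise_def inner_diff_left algebra_simps)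
  show "integrable M (\<lambda>\<omega>. W \<omega> * (noise t i \<omega> \<bullet> b))" unfolding eq using int by simp
  have "(\<integral>\<^sup>+\<omega>. ennreal (?a \<omega>) \<partial>M) = (\<integral>\<^sup>+\<omega>. ennreal (W \<omega>) * ennreal (g t i \<omega> \<bullet> b + G) \<partial>M)"
    using W(2) by (intro nn_integral_cong) (simp add: ennreal_mult')
  also have "\<dots> = (\<integral>\<^sup>+\<omega>. ennreal (W \<omega>) * (\<integral>\<^sup>+y. ennreal (y \<bullet> b + G) \<partial>Orc (x t \<omega>)) \<partial>M)"
    using W(1) by (intro fresh_sample_nn_integral[OF t i]) auto
  also have "\<dots> = (\<integral>\<^sup>+\<omega>. ennreal (?c \<omega>) \<partial>M)"
    using W(2) nn_integral_oracle_inner[OF t _ b] by (intro nn_integral_cong) (simp add: ennreal_mult')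
  finally have "integral\<^sup>L M ?a = integral\<^sup>L M ?c"
    using meas a c by (simp add: integral_eq_nn_integral)
  then show "(\<integral>\<omega>. W \<omega> * (noise t i \<omega> \<bullet> b) \<partial>M) = 0" unfolding eq using int by simp
qed

text \<open>Given \<open>F t\<close>, the shifted coordinates of two samples are independent with
  common mean \<open>C\<close>, so their product has the same integral as \<open>C * C\<close>. What
  remains are single noises weighted by \<open>C\<close>, which vanish by
  \<open>expectation_noise_mult\<close>.\<close>

lemma expectation_noise_pair:
  assumes t: "1 \<le> t" and ij: "i < m t" "j < m t" "i \<noteq> j" and b: "b \<in> Basis"
  shows "(\<integral>\<omega>. (noise t i \<omega> \<bullet> b) * (noise t j \<omega> \<bullet> b) \<partial>M) = 0"
proof -
  define C where "C \<omega> = f' (x t \<omega>) \<bullet> b + G" for \<omega>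
  define a where "a k \<omega> = g t k \<omega> \<bullet> b + G" for k \<omega>
  have Cm: "C \<in> borel_measurable (F t)" unfolding C_def using gradient_adapted[OF t] by simp
  have Cb: "0 \<le> C \<omega> \<and> C \<omega> \<le> 2 * G" if "\<omega> \<in> space M" for \<omega>
    using abs_inner_Basis_le[OF b norm_gradient_le[OF x_in_K[OF t that]]] by (auto simp: C_def)
  have am: "a k \<in> borel_measurable M" if "k < m t" for k
    unfolding a_def using g_measurable[OF t that] by simp
  have ab: "AE \<omega> in M. 0 \<le> a k \<omega> \<and> a k \<omega> \<le> 2 * G" if "k < m t" for k
    using AE_norm_sample_le[OF t that]
  proof eventually_elim
    case (elim \<omega>)
    then show ?case using abs_inner_Basis_le[OF b, of "g t k \<omega>"] by (force simp: a_def)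
  qed
  have aab: "AE \<omega> in M. 0 \<le> a i \<omega> * a j \<omega> \<and> a i \<omega> * a j \<omega> \<le> (2 * G) * (2 * G)"
    using ab[OF ij(1)] ab[OF ij(2)]
  proof eventually_elim
    case (elim \<omega>)
    then show ?case using G_nonneg by (intro conjI mult_nonneg_nonneg mult_mono) auto
  qed
  have CCb: "0 \<le> C \<omega> * C \<omega> \<and> C \<omega> * C \<omega> \<le> (2 * G) * (2 * G)" if "\<omega> \<in> space M" for \<omega>
    using Cb[OF that] G_nonneg by (intro conjI mult_nonneg_nonneg mult_mono) auto
  have meas: "(\<lambda>\<omega>. a i \<omega> * a j \<omega>) \<in> borel_measurable M" "(\<lambda>\<omega>. C \<omega> * C \<omega>) \<in> borel_measurable M"
    using am ij measurable_F_M[OF Cm] by auto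
  have int: "integrable M (\<lambda>\<omega>. a i \<omega> * a j \<omega>)" "integrable M (\<lambda>\<omega>. C \<omega> * C \<omega>)"
    using meas aab CCb by (auto intro!: integrable_AE_bounded[where B="(2 * G) * (2 * G)"])
  have "(\<integral>\<^sup>+\<omega>. ennreal (a i \<omega> * a j \<omega>) \<partial>M) = (\<integral>\<^sup>+\<omega>. ennreal (a i \<omega>) * ennreal (a j \<omega>) \<partial>M)"
    using ab[OF ij(1)] by (intro nn_integral_cong_AE) (auto simp: ennreal_mult')
  also have "\<dots> = (\<integral>\<^sup>+\<omega>. (\<integral>\<^sup>+y. ennreal (y \<bullet> b + G) \<partial>Orc (x t \<omega>)) *
      (\<integral>\<^sup>+y. ennreal (y \<bullet> b + G) \<partial>Orc (x t \<omega>)) \<partial>M)"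
    unfolding a_def by (intro fresh_sample_pair_nn_integral[OF t ij]) auto
  also have "\<dots> = (\<integral>\<^sup>+\<omega>. ennreal (C \<omega> * C \<omega>) \<partial>M)"
    using Cb nn_integral_oracle_inner[OF t _ b] by (intro nn_integral_cong) (simp add: ennreal_mult' C_def)
  finally have eq: "(\<integral>\<omega>. a i \<omega> * a j \<omega> \<partial>M) = (\<integral>\<omega>. C \<omega> * C \<omega> \<partial>M)"
    using meas aab CCb by (simp add: integral_eq_nn_integral)
  have split: "(noise t i \<omega> \<bullet> b) * (noise t j \<omega> \<bullet> b) =
      (a i \<omega> * a j \<omega> - C \<omega> * C \<omega>) - C \<omega> * (noise t i \<omega> \<bullet> b) - C \<omega> * (noise t j \<omega> \<bullet> b)" for \<omega>
    by (simp add: noise_def a_def C_def inner_diff_left algebra_simps)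
  show ?thesis
    unfolding split using int eq expectation_noise_mult[OF t ij(1) b Cm Cb] expectation_noise_mult[OF t ij(2) b Cm Cb]
    by simp
qed

lemma integrable_noise_inner:
  assumes t: "1 \<le> t" and ij: "i < m t" "j < m t"
  shows "integrable M (\<lambda>\<omega>. noise t i \<omega> \<bullet> noise t j \<omega>)"
    and "b \<in> Basis \<Longrightarrow> integrable M (\<lambda>\<omega>. (noise t i \<omega> \<bullet> b) * (noise t j \<omega> \<bullet> b))"
proof -
  show "integrable M (\<lambda>\<omega>. noise t i \<omega> \<bullet> noise t j \<omega>)"
  proof (rule integrable_AE_bounded)
    show "(\<lambda>\<omega>. noise t i \<omega> \<bullet> noise t j \<omega>) \<in> borel_measurable M"
      using noise_measurable[OF t] ij by simp
    show "AE \<omega> in M. \<bar>noise t i \<omega> \<bullet> noise t j \<omega>\<bar> \<le> (2 * G) * (2 * G)"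
      using AE_norm_noise_le[OF t ij(1)] AE_norm_noise_le[OF t ij(2)]
    proof eventually_elim
      case (elim \<omega>)
      then show ?case
        by (intro order_trans[OF Cauchy_Schwarz_ineq2] mult_mono) (auto simp: G_nonneg)
    qed
  qed
  show "integrable M (\<lambda>\<omega>. (noise t i \<omega> \<bullet> b) * (noise t j \<omega> \<bullet> b))" if b: "b \<in> Basis"
  proof (rule integrable_AE_bounded)
    show "(\<lambda>\<omega>. (noise t i \<omega> \<bullet> b) * (noise t j \<omega> \<bullet> b)) \<in> borel_measurable M"
      using noise_measurable[OF t] ij by simp
    show "AE \<omega> in M. \<bar>(noise t i \<omega> \<bullet> b) * (noise t j \<omega> \<bullet> b)\<bar> \<le> (2 * G) * (2 * G)"
      using AE_norm_noise_le[OF t ij(1)] AE_norm_noise_le[OF t ij(2)]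
    proof eventually_elim
      case (elim \<omega>)
      then show ?case unfolding abs_mult
        by (intro mult_mono abs_inner_Basis_le[OF b]) (auto simp: G_nonneg)
    qed
  qed
qed

text \<open>Orthogonality in each coordinate gives the first claim. For the second, variance is at
  most the second moment because the cross term with the gradient integrates to zero; this yields
  \<open>G\<^sup>2\<close>, although pointwise the noise is only bounded by
  \<open>2 * G\<close>.\<close>

lemma expectation_noise_inner:
  assumes t: "1 \<le> t" and ij: "i < m t" "j < m t"
  shows "i \<noteq> j \<Longrightarrow> (\<integral>\<omega>. noise t i \<omega> \<bullet> noise t j \<omega> \<partial>M) = 0"
    and "(\<integral>\<omega>. noise t i \<omega> \<bullet> noise t i \<omega> \<partial>M) \<le> G\<^sup>2"
proof -
  have "(\<integral>\<omega>. noise t i \<omega> \<bullet> noise t j \<omega> \<partial>M) = (\<Sum>b\<in>Basis. \<integral>\<omega>. (noise t i \<omega> \<bullet> b) * (noise t j \<omega> \<bullet> b) \<partial>M)"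
    by (subst euclidean_inner) (use integrable_noise_inner(2)[OF t ij] in simp)
  then show "(\<integral>\<omega>. noise t i \<omega> \<bullet> noise t j \<omega> \<partial>M) = 0" if "i \<noteq> j"
    using expectation_noise_pair[OF t ij that] by simp
  let ?r = "\<lambda>b \<omega>. (f' (x t \<omega>) \<bullet> b) * (noise t i \<omega> \<bullet> b)"
  have r: "integrable M (?r b)" "integral\<^sup>L M (?r b) = 0" if b: "b \<in> Basis" for b
  proof -
    have C: "0 \<le> f' (x t \<omega>) \<bullet> b + G \<and> f' (x t \<omega>) \<bullet> b + G \<le> 2 * G" if "\<omega> \<in> space M" for \<omega>
      using abs_inner_Basis_le[OF b norm_gradient_le[OF x_in_K[OF t that]]] by auto
    \<comment> \<open>The coordinate of the gradient may be negative, so it is written as the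
      difference of the nonnegative weights \<open>f' (x t \<omega>) \<bullet> b + G\<close> and
      \<open>G\<close>.\<close>
    have eq: "?r b = (\<lambda>\<omega>. (f' (x t \<omega>) \<bullet> b + G) * (noise t i \<omega> \<bullet> b) - G * (noise t i \<omega> \<bullet> b))"
      by (simp add: algebra_simps)
    have Gm: "(\<lambda>_. G) \<in> borel_measurable (F t)" "\<And>\<omega>. \<omega> \<in> space M \<Longrightarrow> 0 \<le> G \<and> G \<le> G"
      using G_nonneg by auto
    have Cm: "(\<lambda>\<omega>. f' (x t \<omega>) \<bullet> b + G) \<in> borel_measurable (F t)" using gradient_adapted[OF t] by simp
    note 1 = expectation_noise_mult[OF t ij(1) b Cm C]
    note 2 = expectation_noise_mult[OF t ij(1) b Gm]
    show "integrable M (?r b)" unfolding eq by (rule Bochner_Integration.integrable_diff[OF 1(1) 2(1)])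
    show "integral\<^sup>L M (?r b) = 0" unfolding eq
      using Bochner_Integration.integral_diff[OF 1(1) 2(1)] 1(2) 2(2) by simp
  qed
  have "noise t i \<omega> \<bullet> noise t i \<omega> \<le> (norm (g t i \<omega>))\<^sup>2 - 2 * (\<Sum>b\<in>Basis. ?r b \<omega>)" for \<omega>
  proof -
    have "(norm (g t i \<omega>))\<^sup>2 = noise t i \<omega> \<bullet> noise t i \<omega> + 2 * (f' (x t \<omega>) \<bullet> noise t i \<omega>)
        + f' (x t \<omega>) \<bullet> f' (x t \<omega>)"
      unfolding power2_norm_eq_inner by (simp add: noise_def inner_diff inner_commute algebra_simps)
    moreover have "f' (x t \<omega>) \<bullet> noise t i \<omega> = (\<Sum>b\<in>Basis. ?r b \<omega>)" by (rule euclidean_inner)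
    ultimately show ?thesis by simp
  qed
  note le = this
  have "AE \<omega> in M. noise t i \<omega> \<bullet> noise t i \<omega> \<le> G\<^sup>2 - 2 * (\<Sum>b\<in>Basis. ?r b \<omega>)"
    using AE_norm_sample_le[OF t ij(1)]
  proof eventually_elim
    case (elim \<omega>)
    then have "(norm (g t i \<omega>))\<^sup>2 \<le> G\<^sup>2" by (simp add: power_mono)
    with le[of \<omega>] show ?case by linarith
  qed
  then have "(\<integral>\<omega>. noise t i \<omega> \<bullet> noise t i \<omega> \<partial>M) \<le> (\<integral>\<omega>. G\<^sup>2 - 2 * (\<Sum>b\<in>Basis. ?r b \<omega>) \<partial>M)"
    using integrable_noise_inner(1)[OF t ij(1) ij(1)] r by (intro integral_mono_AE) auto
  also have "\<dots> = G\<^sup>2" using r by (simp add: prob_space)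
  finally show "(\<integral>\<omega>. noise t i \<omega> \<bullet> noise t i \<omega> \<partial>M) \<le> G\<^sup>2" .
qed

section \<open>The averaged gradient and its mean error\<close>

definition batch_gradient :: "nat \<Rightarrow> 'w \<Rightarrow> 'a" where
  "batch_gradient t \<omega> = (1 / real (m t)) *\<^sub>R (\<Sum>i<m t. g t i \<omega>)"

definition gradient_error :: "nat \<Rightarrow> 'w \<Rightarrow> real" where
  "gradient_error t \<omega> = norm (f' (x t \<omega>) - batch_gradient t \<omega>)"

lemma gradient_error_measurable: "1 \<le> t \<Longrightarrow> gradient_error t \<in> borel_measurable M"
  unfolding gradient_error_def batch_gradient_def
  using g_measurable measurable_F_M[OF gradient_adapted] by simp

text \<open>In the double sum over pairs of noises the off-diagonal terms vanish in expectation,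
  leaving \<open>m t\<close> diagonal terms of at most \<open>G\<^sup>2\<close> each, divided by
  \<open>(real (m t))\<^sup>2\<close>.\<close>

lemma expectation_gradient_error_sq:
  assumes t: "1 \<le> t"
  shows "integrable M (\<lambda>\<omega>. (gradient_error t \<omega>)\<^sup>2)"
    and "(\<integral>\<omega>. (gradient_error t \<omega>)\<^sup>2 \<partial>M) \<le> G\<^sup>2 / m t"
proof -
  have m: "real (m t) > 0" using batch_pos[OF t] by simp
  have eq: "(gradient_error t \<omega>)\<^sup>2 = (\<Sum>i<m t. \<Sum>j<m t. noise t i \<omega> \<bullet> noise t j \<omega>) / (real (m t))\<^sup>2" for \<omega>
  proof -
    have "(\<Sum>i<m t. noise t i \<omega>) = (\<Sum>i<m t. g t i \<omega>) - real (m t) *\<^sub>R f' (x t \<omega>)"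
      by (simp add: noise_def sum_subtractf sum_constant_scaleR)
    then have "f' (x t \<omega>) - batch_gradient t \<omega> = (- 1 / real (m t)) *\<^sub>R (\<Sum>i<m t. noise t i \<omega>)"
      using m by (simp add: batch_gradient_def scaleR_diff_right)
    then have "gradient_error t \<omega> = norm (\<Sum>i<m t. noise t i \<omega>) / real (m t)"
      by (simp add: gradient_error_def)
    moreover have "(norm (\<Sum>i<m t. noise t i \<omega>))\<^sup>2 = (\<Sum>i<m t. \<Sum>j<m t. noise t i \<omega> \<bullet> noise t j \<omega>)"
      unfolding power2_norm_eq_inner by (subst inner_sum_left) (simp only: inner_sum_right)
    ultimately show ?thesis by (simp add: power_divide)
  qed
  show "integrable M (\<lambda>\<omega>. (gradient_error t \<omega>)\<^sup>2)"
    unfolding eq using integrable_noise_inner(1)[OF t]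
    by (intro integrable_divide_zero Bochner_Integration.integrable_sum) auto
  have "(\<integral>\<omega>. (gradient_error t \<omega>)\<^sup>2 \<partial>M) =
      (\<Sum>i<m t. \<Sum>j<m t. \<integral>\<omega>. noise t i \<omega> \<bullet> noise t j \<omega> \<partial>M) / (real (m t))\<^sup>2"
  proof -
    have "(\<integral>\<omega>. (\<Sum>j<m t. noise t i \<omega> \<bullet> noise t j \<omega>) \<partial>M) = (\<Sum>j<m t. \<integral>\<omega>. noise t i \<omega> \<bullet> noise t j \<omega> \<partial>M)"
      if "i < m t" for i
      using integrable_noise_inner(1)[OF t that] by (intro Bochner_Integration.integral_sum) auto
    moreover have "(\<integral>\<omega>. (\<Sum>i<m t. \<Sum>j<m t. noise t i \<omega> \<bullet> noise t j \<omega>) \<partial>M) =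
        (\<Sum>i<m t. \<integral>\<omega>. (\<Sum>j<m t. noise t i \<omega> \<bullet> noise t j \<omega>) \<partial>M)"
      using integrable_noise_inner(1)[OF t]
      by (intro Bochner_Integration.integral_sum Bochner_Integration.integrable_sum) auto
    ultimately show ?thesis unfolding eq by simp
  qed
  also have "\<dots> \<le> (\<Sum>i<m t. G\<^sup>2) / (real (m t))\<^sup>2"
  proof (intro divide_right_mono sum_mono)
    fix i assume i: "i \<in> {..<m t}"
    have "(\<Sum>j<m t. \<integral>\<omega>. noise t i \<omega> \<bullet> noise t j \<omega> \<partial>M) = (\<Sum>j\<in>{i}. \<integral>\<omega>. noise t i \<omega> \<bullet> noise t j \<omega> \<partial>M)"
      using i expectation_noise_inner(1)[OF t] by (intro sum.mono_neutral_right) auto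
    then show "(\<Sum>j<m t. \<integral>\<omega>. noise t i \<omega> \<bullet> noise t j \<omega> \<partial>M) \<le> G\<^sup>2"
      using i expectation_noise_inner(2)[OF t] by simp
  qed simp
  also have "\<dots> = G\<^sup>2 / m t" using m by (simp add: power2_eq_square)
  finally show "(\<integral>\<omega>. (gradient_error t \<omega>)\<^sup>2 \<partial>M) \<le> G\<^sup>2 / m t" .
qed

text \<open>Jensen's inequality in the form that a variance is nonnegative; integrability comes from
  \<open>\<bar>y\<bar> \<le> 1 + y\<^sup>2\<close>.\<close>

lemma expectation_gradient_error:
  assumes t: "1 \<le> t"
  shows "integrable M (gradient_error t)"
    and "(\<integral>\<omega>. gradient_error t \<omega> \<partial>M) \<le> G / sqrt (m t)"
proof -
  note sq = expectation_gradient_error_sq[OF t]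
  show int: "integrable M (gradient_error t)"
  proof (rule Bochner_Integration.integrable_bound)
    show "integrable M (\<lambda>\<omega>. 1 + (gradient_error t \<omega>)\<^sup>2)" using sq(1) by simp
    show "gradient_error t \<in> borel_measurable M" by (rule gradient_error_measurable[OF t])
    have "\<bar>y\<bar> \<le> 1 + y\<^sup>2" for y :: real
      using zero_le_power2[of "\<bar>y\<bar> - 1"] by (simp add: power2_diff)
    then show "AE \<omega> in M. norm (gradient_error t \<omega>) \<le> norm (1 + (gradient_error t \<omega>)\<^sup>2)"
      by (intro AE_I2) (simp add: order_trans[OF _ abs_ge_self])
  qed
  have "(\<integral>\<omega>. gradient_error t \<omega> \<partial>M)\<^sup>2 \<le> (\<integral>\<omega>. (gradient_error t \<omega>)\<^sup>2 \<partial>M)"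
    using variance_eq[OF int sq(1)] variance_positive[of "gradient_error t"] by simp
  also have "\<dots> \<le> (G / sqrt (m t))\<^sup>2" using sq(2) by (simp add: power_divide)
  finally show "(\<integral>\<omega>. gradient_error t \<omega> \<partial>M) \<le> G / sqrt (m t)"
    by (rule power2_le_imp_le) (simp add: G_nonneg)
qed

end

section \<open>Convergence rate\<close>

lemma batch_size_lower:
  assumes pos: "0 < \<alpha>" "0 < \<beta>" "0 < G" "0 < D" "0 \<le> Ds" and t: "1 \<le> t"
  shows "1 \<le> batch_size \<alpha> \<beta> G D Ds t"
    and "G / sqrt (batch_size \<alpha> \<beta> G D Ds t) \<le> \<beta> * D / (real t + 1)"
    and "D * (G / sqrt (batch_size \<alpha> \<beta> G D Ds t)) \<le>
      \<beta> * Ds\<^sup>2 / (real t + 1) + 8 * (\<beta>\<^sup>2 * D\<^sup>2 / \<alpha>) / (real t + 1)\<^sup>2"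
proof -
  let ?m = "batch_size \<alpha> \<beta> G D Ds t"
  define s where "s = real t + 1"
  have s: "s > 0" by (simp add: s_def)
  \<comment> \<open>These are the square roots of the three quantities in the batch size. Dividing
    \<open>G\<close> by any of them bounds \<open>G / sqrt ?m\<close> as soon as its square is at
    most \<open>?m\<close>; rounding up only helps here.\<close>
  define a q r where "a = G * s / (\<beta> * D)" and "q = \<alpha> * G * s\<^sup>2 / (8 * \<beta>\<^sup>2 * D)" and "r = G * D * s / (\<beta> * Ds\<^sup>2)"
  have a: "0 < a" and q: "0 < q" using pos s by (auto simp: a_def q_def)
  have m: "max (a\<^sup>2) (if Ds = 0 then q\<^sup>2 else min (r\<^sup>2) (q\<^sup>2)) \<le> real ?m"
    unfolding batch_size_def Let_def a_def q_def r_def s_def by linarith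
  then have am: "a\<^sup>2 \<le> real ?m" by simp
  then have "0 < real ?m" using a by (smt (verit) zero_less_power)
  then show "1 \<le> ?m" by simp
  have le: "G / sqrt ?m \<le> G / y" if "0 < y" "y\<^sup>2 \<le> real ?m" for y
    using that pos real_le_rsqrt[OF that(2)] by (intro frac_le) auto
  show "G / sqrt ?m \<le> \<beta> * D / (real t + 1)"
    using le[OF a am] pos s by (simp add: a_def s_def)
  have Q: "D * (G / sqrt ?m) \<le> 8 * (\<beta>\<^sup>2 * D\<^sup>2 / \<alpha>) / s\<^sup>2" if "q\<^sup>2 \<le> real ?m"
  proof -
    have "D * (G / sqrt ?m) \<le> D * (G / q)" using le[OF q that] pos by (intro mult_left_mono) auto
    also have "\<dots> = 8 * (\<beta>\<^sup>2 * D\<^sup>2 / \<alpha>) / s\<^sup>2" using pos s by (simp add: q_def power2_eq_square)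
    finally show ?thesis .
  qed
  have R: "D * (G / sqrt ?m) \<le> \<beta> * Ds\<^sup>2 / s" if "r\<^sup>2 \<le> real ?m" "Ds \<noteq> 0"
  proof -
    have r: "0 < r" using pos s that by (auto simp: r_def)
    have "D * (G / sqrt ?m) \<le> D * (G / r)" using le[OF r that(1)] pos by (intro mult_left_mono) auto
    also have "\<dots> = \<beta> * Ds\<^sup>2 / s" using pos s by (simp add: r_def)
    finally show ?thesis .
  qed
  have "0 \<le> \<beta> * Ds\<^sup>2 / s" "0 \<le> 8 * (\<beta>\<^sup>2 * D\<^sup>2 / \<alpha>) / s\<^sup>2" using pos s by auto
  \<comment> \<open>The inner minimum is \<open>r\<^sup>2\<close> or \<open>q\<^sup>2\<close>, so
    \<open>R\<close> or \<open>Q\<close> applies, and the sum of both bounds covers either case. For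
    \<open>Ds = 0\<close> it is \<open>Q\<close>.\<close>
  then have "D * (G / sqrt ?m) \<le> \<beta> * Ds\<^sup>2 / s + 8 * (\<beta>\<^sup>2 * D\<^sup>2 / \<alpha>) / s\<^sup>2"
    using m Q R by (cases "Ds = 0"; cases "r\<^sup>2 \<le> q\<^sup>2") auto
  then show "D * (G / sqrt ?m) \<le> \<beta> * Ds\<^sup>2 / (real t + 1) + 8 * (\<beta>\<^sup>2 * D\<^sup>2 / \<alpha>) / (real t + 1)\<^sup>2"
    by (simp add: s_def)
qed

text \<open>The summand 1 pays for rounding up, the maximum is at most the sum, and a minimum is at
  most either argument. For \<open>Ds = 0\<close> the last quotient of the second form would
  evaluate to 0, while the batch size is then governed by the first form.\<close>

lemma batch_size_upper:
  shows "real (batch_size \<alpha> \<beta> G D Ds t) \<le>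
      1 + (G * (real t + 1) / (\<beta> * D))\<^sup>2 + (\<alpha> * G * (real t + 1)\<^sup>2 / (8 * \<beta>\<^sup>2 * D))\<^sup>2"
    and "Ds \<noteq> 0 \<Longrightarrow> real (batch_size \<alpha> \<beta> G D Ds t) \<le>
      1 + (G * (real t + 1) / (\<beta> * D))\<^sup>2 + (G * D * (real t + 1) / (\<beta> * Ds\<^sup>2))\<^sup>2"
proof -
  define a q r where "a = G * (real t + 1) / (\<beta> * D)" and "q = \<alpha> * G * (real t + 1)\<^sup>2 / (8 * \<beta>\<^sup>2 * D)"
    and "r = G * D * (real t + 1) / (\<beta> * Ds\<^sup>2)"
  have m: "batch_size \<alpha> \<beta> G D Ds t = nat \<lceil>max (a\<^sup>2) (if Ds = 0 then q\<^sup>2 else min (r\<^sup>2) (q\<^sup>2))\<rceil>"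
    unfolding batch_size_def Let_def a_def q_def r_def by simp
  have ceil: "real (nat \<lceil>y\<rceil>) \<le> 1 + y" if "0 \<le> y" for y using that by linarith
  have le: "real (nat \<lceil>max y z\<rceil>) \<le> 1 + y + w" if "0 \<le> y" "z \<le> w" "0 \<le> w" for y z w
    using ceil[of "max y z"] that by linarith
  have "real (batch_size \<alpha> \<beta> G D Ds t) \<le> 1 + a\<^sup>2 + q\<^sup>2"
    unfolding m by (rule le) auto
  then show "real (batch_size \<alpha> \<beta> G D Ds t) \<le>
      1 + (G * (real t + 1) / (\<beta> * D))\<^sup>2 + (\<alpha> * G * (real t + 1)\<^sup>2 / (8 * \<beta>\<^sup>2 * D))\<^sup>2"
    by (simp add: a_def q_def)
  have "real (batch_size \<alpha> \<beta> G D Ds t) \<le> 1 + a\<^sup>2 + r\<^sup>2" if "Ds \<noteq> 0"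
    unfolding m using that by (intro le) auto
  then show "Ds \<noteq> 0 \<Longrightarrow> real (batch_size \<alpha> \<beta> G D Ds t) \<le>
      1 + (G * (real t + 1) / (\<beta> * D))\<^sup>2 + (G * D * (real t + 1) / (\<beta> * Ds\<^sup>2))\<^sup>2"
    by (simp add: a_def r_def)
qed

text \<open>With \<open>\<eta> t = 2 / (t + 1)\<close>, multiplying the recursion by \<open>t * (t + 1)\<close> makes it telescope.\<close>

lemma recursion_mult:
  fixes e e' b :: real
  assumes "1 \<le> t" and "e' \<le> (1 - 2 / (real t + 1)) * e + b"
  shows "real (Suc t) * (real (Suc t) - 1) * e' \<le> real t * (real t - 1) * e + real t * (real t + 1) * b"
proof -
  have "real t * (real t + 1) * e' \<le> real t * (real t + 1) * ((1 - 2 / (real t + 1)) * e + b)"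
    using assms by (intro mult_left_mono) auto
  also have "\<dots> = real t * (real t - 1) * e + real t * (real t + 1) * b"
    by (simp add: field_simps)
  finally show ?thesis by (simp add: algebra_simps)
qed

text \<open>The weight \<open>t * (t - 1)\<close> vanishes at \<open>t = 1\<close>, so the initial
  error drops out; thereafter each step adds at most \<open>c\<close> to the weighted error.\<close>

lemma recursion_rate:
  fixes e :: "nat \<Rightarrow> real"
  assumes rec: "\<And>t. 1 \<le> t \<Longrightarrow> e (Suc t) \<le> (1 - 2 / (real t + 1)) * e t + c / (real t + 1)\<^sup>2"
    and c: "0 \<le> c" and t: "2 \<le> t"
  shows "e t \<le> c / t"
proof -
  have "real t * (real t - 1) * e t \<le> c * (real t - 1)" if "1 \<le> t" for t
    using that
  proof (induction t rule: nat_induct_at_least)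
    case (Suc t)
    have "real t * (real t + 1) * (c / (real t + 1)\<^sup>2) = c * (real t / (real t + 1))"
      by (simp add: power2_eq_square)
    also have "\<dots> \<le> c * 1" using c by (intro mult_left_mono) auto
    finally show ?case using recursion_mult[OF Suc.hyps rec[OF Suc.hyps]] Suc.IH
      by (simp add: algebra_simps)
  qed simp
  from this[of t] t have "(real t - 1) * (real t * e t) \<le> (real t - 1) * c" by (simp add: algebra_simps)
  then have "real t * e t \<le> c" using t by (simp add: mult_le_cancel_left_pos)
  then show ?thesis using t by (simp add: field_simps)
qed

text \<open>After weighting by \<open>t * (t + 1)\<close> the increments are at most
  \<open>4 * P + 32 * Q / (t + 1)\<close>, and the second part sums harmonically, hence the
  logarithm. The induction begins at 2, where the weight 2 turns \<open>17 * Q\<close> into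
  \<open>34 * Q\<close>.\<close>

lemma recursion_rate_log:
  fixes e :: "nat \<Rightarrow> real"
  assumes rec: "\<And>t. 2 \<le> t \<Longrightarrow> e (Suc t) \<le> (1 - 2 / (real t + 1)) * e t
      + (4 * P / (real t + 1)\<^sup>2 + 16 * Q / (real t * (real t + 1)\<^sup>2) + 16 * Q / (real t + 1) ^ 3)"
    and base: "e 2 \<le> P + 17 * Q" and PQ: "0 \<le> P" "0 \<le> Q" and t: "2 \<le> t"
  shows "e t \<le> 4 * P / t + 68 * Q * (1 + ln t) / (real t)\<^sup>2"
proof -
  have *: "real t * (real t - 1) * e t \<le> 4 * P * (real t - 1) + 34 * Q + 32 * Q * ln t" if "2 \<le> t" for t
    using that
  proof (induction t rule: nat_induct_at_least)
    case base
    have "0 \<le> 32 * Q * ln 2" using PQ by simp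
    then have "2 * e 2 \<le> 4 * P + 34 * Q + 32 * Q * ln 2" using \<open>e 2 \<le> P + 17 * Q\<close> PQ by linarith
    then show ?case by simp
  next
    case (Suc t)
    define s where "s = real t + 1"
    have t: "real t \<ge> 2" and s: "s \<ge> 3" using Suc.hyps by (auto simp: s_def)
    have 1: "real t * s * (4 * P / s\<^sup>2) \<le> 4 * P"
    proof -
      have "real t * s * (4 * P / s\<^sup>2) = 4 * P * (real t / s)" using s by (simp add: power2_eq_square)
      also have "\<dots> \<le> 4 * P * 1" using PQ s by (intro mult_left_mono) (auto simp: s_def)
      finally show ?thesis by simp
    qed
    have 2: "real t * s * (16 * Q / (real t * s\<^sup>2)) = 16 * Q * (1 / s)"
      using s t by (simp add: power2_eq_square)
    have 3: "real t * s * (16 * Q / s ^ 3) \<le> 16 * Q * (1 / s)"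
    proof -
      have "real t * s * (16 * Q / s ^ 3) = 16 * Q * (1 / s) * (real t / s)"
        using s by (simp add: power3_eq_cube)
      also have "\<dots> \<le> 16 * Q * (1 / s) * 1" using PQ s by (intro mult_left_mono) (auto simp: s_def)
      finally show ?thesis by simp
    qed
    \<comment> \<open>The harmonic increment is paid by the growth of the logarithm:
      \<open>1 / s \<le> ln s - ln t\<close> for \<open>s = t + 1\<close>.\<close>
    have "ln (real t / s) \<le> real t / s - 1" using t s by (intro ln_le_minus_one) auto
    also have "real t / s - 1 = - (1 / s)" using s by (simp add: s_def field_simps)
    finally have "1 / s \<le> ln s - ln t" using t s by (simp add: ln_div)
    then have 4: "32 * Q * (1 / s) \<le> 32 * Q * (ln s - ln t)" using PQ by (intro mult_left_mono) auto
    have "real t * s * (4 * P / s\<^sup>2 + 16 * Q / (real t * s\<^sup>2) + 16 * Q / s ^ 3) \<le> 4 * P + 32 * Q * (ln s - ln t)"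
      using 1 2 3 4 by (simp add: distrib_left)
    moreover have "real (Suc t) * (real (Suc t) - 1) * e (Suc t) \<le> real t * (real t - 1) * e t +
        real t * s * (4 * P / s\<^sup>2 + 16 * Q / (real t * s\<^sup>2) + 16 * Q / s ^ 3)"
      using recursion_mult[OF _ rec[OF Suc.hyps]] Suc.hyps by (simp add: s_def)
    moreover have "real (Suc t) = s" by (simp add: s_def)
    ultimately show ?case using Suc.IH by (simp add: algebra_simps s_def)
  qed
  define u where "u = real t"
  have u: "2 \<le> u" using t by (simp add: u_def)
  have Qln: "0 \<le> Q * (1 + ln u)" using PQ u by simp
  have "0 \<le> Q * ln u" using PQ u by simp
  then have "u * (u - 1) * e t \<le> 4 * P * (u - 1) + 34 * Q * (1 + ln u)"
    using *[OF t] PQ by (simp add: u_def algebra_simps)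
  then have "e t \<le> (4 * P * (u - 1) + 34 * Q * (1 + ln u)) / (u * (u - 1))"
    using u by (simp add: pos_le_divide_eq mult.commute)
  also have "\<dots> = 4 * P / u + 34 * (Q * (1 + ln u)) / u * (1 / (u - 1))"
    using u by (simp add: field_simps)
  \<comment> \<open>From \<open>u = 2\<close> on, \<open>1 / (u - 1) \<le> 2 / u\<close>; this
    doubles 34 to 68.\<close>
  also have "34 * (Q * (1 + ln u)) / u * (1 / (u - 1)) \<le> 34 * (Q * (1 + ln u)) / u * (2 / u)"
    using u Qln by (intro mult_left_mono) (auto simp: field_simps)
  also have "34 * (Q * (1 + ln u)) / u * (2 / u) = 68 * Q * (1 + ln u) / u\<^sup>2"
    by (simp add: power2_eq_square)
  finally show ?thesis by (simp add: u_def)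
qed

section \<open>Expected error of the run\<close>

locale nep_batched =
  stochastic_nep_problem K f f' \<alpha> \<beta> S M F Orc "\<lambda>t. 2 / (real t + 1)"
    "batch_size \<alpha> \<beta> G (diameter K) (diameter S)" x v g G
  for K :: "'a::euclidean_space set" and f f' \<alpha> \<beta> S and M :: "'w measure" and F Orc x v g G +
  assumes G_pos: "0 < G" and diameter_pos: "0 < diameter K"
begin

text \<open>First-order convexity and Cauchy-Schwarz. This crude bound makes the error integrable
  and settles the case \<open>G * diameter K \<le> \<epsilon>\<close>.\<close>

lemma gap_le: "y \<in> K \<Longrightarrow> gap y \<le> G * diameter K"
proof -
  assume y: "y \<in> K"
  obtain w where w: "w \<in> minimizers K f" "w \<in> K" using nearest_minimizer[OF y] by blast
  have "gap y \<le> norm (f' y) * norm (y - w)"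
    using gap_le_gradient[OF y w(1)] norm_cauchy_schwarz order_trans by blast
  also have "\<dots> \<le> G * diameter K"
    using norm_gradient_le[OF y] norm_le_diameter[OF y w(2)] G_pos by (intro mult_mono) auto
  finally show ?thesis .
qed

definition expected_gap :: "nat \<Rightarrow> real" where
  "expected_gap t = (\<integral>\<omega>. gap (x t \<omega>) \<partial>M)"

lemma integrable_gap: "1 \<le> t \<Longrightarrow> integrable M (\<lambda>\<omega>. gap (x t \<omega>))"
proof (rule integrable_AE_bounded)
  assume t: "1 \<le> t"
  have "continuous_on K gap" unfolding gap_def by (intro continuous_intros continuous_f)
  from measurable_compose[OF x_measurable[OF t] borel_measurable_continuous_on_restrict[OF this]]
  show "(\<lambda>\<omega>. gap (x t \<omega>)) \<in> borel_measurable M" by (rule measurable_F_M)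
  show "AE \<omega> in M. \<bar>gap (x t \<omega>)\<bar> \<le> G * diameter K"
    using gap_nonneg gap_le x_in_K[OF t] by (intro AE_I2) (simp add: abs_of_nonneg)
qed

lemma expected_gap_le:
  assumes "1 \<le> t" shows "expected_gap t \<le> G * diameter K"
proof -
  have "expected_gap t \<le> (\<integral>\<omega>. G * diameter K \<partial>M)" unfolding expected_gap_def
    using integrable_gap[OF assms] gap_le x_in_K[OF assms] by (intro integral_mono) auto
  then show ?thesis by (simp add: prob_space)
qed

text \<open>The pointwise bounds of \<open>gap_step\<close> are affine in
  \<open>gap (x t \<omega>)\<close> and in the gradient error, so they pass to expectations without
  loss.\<close>

lemma expected_gap_step:
  assumes t: "1 \<le> t"
  defines "e \<equiv> 2 / (real t + 1)" and "\<nu> \<equiv> diameter K * (\<integral>\<omega>. gradient_error t \<omega> \<partial>M)"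
  shows "expected_gap (Suc t) \<le> (1 - e) * expected_gap t + (e * \<nu> + \<beta> * e\<^sup>2 / 2 * (diameter K)\<^sup>2)"
    and "expected_gap (Suc t) \<le> (1 - e) * expected_gap t
        + (e * \<nu> + \<beta> * e\<^sup>2 / 2 * (2 / \<alpha> * expected_gap t + (diameter S)\<^sup>2))"
proof -
  have e: "0 \<le> e" "e \<le> 1" using step_size[OF t] by (auto simp: e_def)
  have step: "gap (x (Suc t) \<omega>) \<le> (1 - e) * gap (x t \<omega>) + e * diameter K * gradient_error t \<omega>
        + \<beta> * e\<^sup>2 / 2 * (diameter K)\<^sup>2"
    "gap (x (Suc t) \<omega>) \<le> (1 - e) * gap (x t \<omega>) + e * diameter K * gradient_error t \<omega>
        + \<beta> * e\<^sup>2 / 2 * (2 / \<alpha> * gap (x t \<omega>) + (diameter S)\<^sup>2)" if \<omega>: "\<omega> \<in> space M" for \<omega>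
    using gap_step[OF nep_step[OF t \<omega>, folded e_def] x_in_K[OF t \<omega>] e]
    unfolding x_step[OF t \<omega>, folded e_def] gradient_error_def batch_gradient_def by auto
  have int: "integrable M (\<lambda>\<omega>. gap (x t \<omega>))" "integrable M (\<lambda>\<omega>. gap (x (Suc t) \<omega>))"
    "integrable M (gradient_error t)"
    using integrable_gap t expectation_gradient_error(1)[OF t] by auto
  have "expected_gap (Suc t) \<le> (\<integral>\<omega>. (1 - e) * gap (x t \<omega>) + e * diameter K * gradient_error t \<omega>
        + \<beta> * e\<^sup>2 / 2 * (diameter K)\<^sup>2 \<partial>M)"
    unfolding expected_gap_def using int step(1) by (intro integral_mono) auto
  also have "\<dots> = (1 - e) * expected_gap t + (e * \<nu> + \<beta> * e\<^sup>2 / 2 * (diameter K)\<^sup>2)"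
    using int by (simp add: expected_gap_def \<nu>_def prob_space)
  finally show "expected_gap (Suc t) \<le> (1 - e) * expected_gap t + (e * \<nu> + \<beta> * e\<^sup>2 / 2 * (diameter K)\<^sup>2)" .
  have "expected_gap (Suc t) \<le> (\<integral>\<omega>. (1 - e) * gap (x t \<omega>) + e * diameter K * gradient_error t \<omega>
        + \<beta> * e\<^sup>2 / 2 * (2 / \<alpha> * gap (x t \<omega>) + (diameter S)\<^sup>2) \<partial>M)"
    unfolding expected_gap_def using int step(2) by (intro integral_mono) auto
  also have "\<dots> = (1 - e) * expected_gap t
        + (e * \<nu> + \<beta> * e\<^sup>2 / 2 * (2 / \<alpha> * expected_gap t + (diameter S)\<^sup>2))"
    using int by (simp add: expected_gap_def \<nu>_def prob_space)
  finally show "expected_gap (Suc t) \<le> (1 - e) * expected_gap t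
        + (e * \<nu> + \<beta> * e\<^sup>2 / 2 * (2 / \<alpha> * expected_gap t + (diameter S)\<^sup>2))" .
qed

lemmas batch_bounds = batch_size_lower[OF \<alpha>_pos \<beta>_pos G_pos diameter_pos diameter_S_nonneg]

text \<open>The noise, by the first batch size bound, and the curvature term each contribute
  \<open>2 * \<beta> * (diameter K)\<^sup>2 / (t + 1)\<^sup>2\<close> to the recursion.\<close>

lemma expected_gap_slow:
  assumes "2 \<le> t"
  shows "expected_gap t \<le> 4 * \<beta> * (diameter K)\<^sup>2 / t"
proof (rule recursion_rate[OF _ _ assms])
  fix t :: nat assume t: "1 \<le> t"
  let ?D = "diameter K"
  define s where "s = real t + 1"
  have s: "s > 0" by (simp add: s_def)
  have "?D * (\<integral>\<omega>. gradient_error t \<omega> \<partial>M) \<le> ?D * (\<beta> * ?D / s)"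
    using order_trans[OF expectation_gradient_error(2)[OF t] batch_bounds(2)[OF t]] diameter_pos
    unfolding s_def by (intro mult_left_mono) auto
  then have "2 / s * (?D * (\<integral>\<omega>. gradient_error t \<omega> \<partial>M)) \<le> 2 / s * (?D * (\<beta> * ?D / s))"
    by (rule mult_left_mono) (use s in simp)
  moreover have "2 / s * (?D * (\<beta> * ?D / s)) + \<beta> * (2 / s)\<^sup>2 / 2 * ?D\<^sup>2 = 4 * \<beta> * ?D\<^sup>2 / s\<^sup>2"
    using s by (simp add: power2_eq_square field_simps)
  ultimately show "expected_gap (Suc t) \<le> (1 - 2 / (real t + 1)) * expected_gap t + 4 * \<beta> * ?D\<^sup>2 / (real t + 1)\<^sup>2"
    using expected_gap_step(1)[OF t, folded s_def] unfolding s_def[symmetric] by linarith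
qed (use \<beta>_pos in simp)

text \<open>Base of the logarithmic recursion. The first step size is 1, so \<open>x 2\<close> is
  \<open>v 1\<close>; the first-step bound contributes 16, and the squared gradient error, at most
  \<open>(\<beta> * diameter K / 2)\<^sup>2\<close> in the mean, contributes one more.\<close>

lemma expected_gap_2:
  "expected_gap 2 \<le> \<beta> * (diameter S)\<^sup>2 + 17 * (\<beta>\<^sup>2 * (diameter K)\<^sup>2 / \<alpha>)"
proof -
  let ?D = "diameter K" and ?Q = "\<beta>\<^sup>2 * (diameter K)\<^sup>2 / \<alpha>"
  have step: "gap (x 2 \<omega>) \<le> 16 * ?Q + 4 / \<alpha> * (gradient_error 1 \<omega>)\<^sup>2 + \<beta> * (diameter S)\<^sup>2"
    if \<omega>: "\<omega> \<in> space M" for \<omega>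
  proof -
    have "x 2 \<omega> = v 1 \<omega>" using x_step[of 1 \<omega>] \<omega> by (simp add: numeral_2_eq_2)
    then show ?thesis
      using gap_first_step[OF _ x_in_K[of 1 \<omega>], of "batch_gradient 1 \<omega>" "v 1 \<omega>"] nep_step[of 1 \<omega>] \<omega>
      by (simp add: gradient_error_def batch_gradient_def)
  qed
  have "expected_gap 2 \<le> (\<integral>\<omega>. 16 * ?Q + 4 / \<alpha> * (gradient_error 1 \<omega>)\<^sup>2 + \<beta> * (diameter S)\<^sup>2 \<partial>M)"
    unfolding expected_gap_def using step integrable_gap[of 2] expectation_gradient_error_sq(1)[of 1]
    by (intro integral_mono) auto
  also have "\<dots> = 16 * ?Q + 4 / \<alpha> * (\<integral>\<omega>. (gradient_error 1 \<omega>)\<^sup>2 \<partial>M) + \<beta> * (diameter S)\<^sup>2"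
    using expectation_gradient_error_sq(1)[of 1] by (simp add: prob_space)
  also have "(\<integral>\<omega>. (gradient_error 1 \<omega>)\<^sup>2 \<partial>M) \<le> (\<beta> * ?D / 2)\<^sup>2"
  proof -
    have "(\<integral>\<omega>. (gradient_error 1 \<omega>)\<^sup>2 \<partial>M) \<le> (G / sqrt (batch_size \<alpha> \<beta> G ?D (diameter S) 1))\<^sup>2"
      using expectation_gradient_error_sq(2)[of 1] by (simp add: power_divide)
    also have "\<dots> \<le> (\<beta> * ?D / 2)\<^sup>2" using batch_bounds(2)[of 1] G_pos by (intro power_mono) auto
    finally show ?thesis .
  qed
  also have "4 / \<alpha> * (\<beta> * ?D / 2)\<^sup>2 = ?Q" by (simp add: power_divide power_mult_distrib)
  finally show ?thesis using \<alpha>_pos by (simp add: divide_right_mono)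
qed

text \<open>Inserting \<open>expected_gap_slow\<close> into the quadratic growth term makes it decay
  like the inverse cube of \<open>t\<close>. Noise and curvature each contribute half of
  \<open>4 * \<beta> * (diameter S)\<^sup>2 / (t + 1)\<^sup>2\<close>.\<close>

lemma expected_gap_fast:
  assumes "2 \<le> t"
  shows "expected_gap t \<le> 4 * (\<beta> * (diameter S)\<^sup>2) / t
    + 68 * (\<beta>\<^sup>2 * (diameter K)\<^sup>2 / \<alpha>) * (1 + ln t) / (real t)\<^sup>2"
proof (rule recursion_rate_log[where e = expected_gap, OF _ expected_gap_2 _ _ assms])
  fix t :: nat assume t2: "2 \<le> t"
  then have t: "1 \<le> t" by simp
  let ?D = "diameter K" and ?Q = "\<beta>\<^sup>2 * (diameter K)\<^sup>2 / \<alpha>" and ?P = "\<beta> * (diameter S)\<^sup>2"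
  define s where "s = real t + 1"
  have s: "s > 0" by (simp add: s_def)
  have "?D * (\<integral>\<omega>. gradient_error t \<omega> \<partial>M) \<le> ?D * (G / sqrt (batch_size \<alpha> \<beta> G ?D (diameter S) t))"
    using expectation_gradient_error(2)[OF t] diameter_pos by (intro mult_left_mono) auto
  also have "\<dots> \<le> ?P / s + 8 * ?Q / s\<^sup>2" using batch_bounds(3)[OF t] by (simp add: s_def)
  finally have 1: "2 / s * (?D * (\<integral>\<omega>. gradient_error t \<omega> \<partial>M)) \<le> 2 / s * (?P / s + 8 * ?Q / s\<^sup>2)"
    using s by (intro mult_left_mono) auto
  have 2: "\<beta> * (2 / s)\<^sup>2 / 2 * (2 / \<alpha> * expected_gap t + (diameter S)\<^sup>2) \<le>
      \<beta> * (2 / s)\<^sup>2 / 2 * (2 / \<alpha> * (4 * \<beta> * ?D\<^sup>2 / t) + (diameter S)\<^sup>2)"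
    using expected_gap_slow[OF t2] \<alpha>_pos \<beta>_pos by (intro mult_left_mono add_right_mono) auto
  have 3: "2 / s * (?P / s + 8 * ?Q / s\<^sup>2) +
      \<beta> * (2 / s)\<^sup>2 / 2 * (2 / \<alpha> * (4 * \<beta> * ?D\<^sup>2 / t) + (diameter S)\<^sup>2) =
      4 * ?P / s\<^sup>2 + 16 * ?Q / (real t * s\<^sup>2) + 16 * ?Q / s ^ 3"
    using s t \<alpha>_pos by (simp add: power2_eq_square power3_eq_cube field_simps)
  show "expected_gap (Suc t) \<le> (1 - 2 / (real t + 1)) * expected_gap t + (4 * ?P / (real t + 1)\<^sup>2
      + 16 * ?Q / (real t * (real t + 1)\<^sup>2) + 16 * ?Q / (real t + 1) ^ 3)"
    using expected_gap_step(2)[OF t, folded s_def] 1 2 3 unfolding s_def[symmetric] by linarith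
qed (use \<alpha>_pos \<beta>_pos in auto)

end

section \<open>Complexity\<close>

lemma log_rate_le:
  fixes P Q \<epsilon> t :: real
  defines "z \<equiv> Q / \<epsilon>"
  assumes pos: "0 < Q" "0 < \<epsilon>" and t0: "0 < t" and t1: "8 * (P / \<epsilon>) \<le> t"
    and t2: "32 * sqrt z * sqrt (1 + \<bar>ln z\<bar>) \<le> t"
  shows "4 * P / t + 68 * Q * (1 + ln t) / t\<^sup>2 \<le> \<epsilon>"
proof -
  define L where "L = 1 + \<bar>ln z\<bar>"
  \<comment> \<open>In this scale the second summand is at most \<open>\<epsilon> / 2\<close>
    exactly when \<open>136 * (1 + ln t) \<le> s\<^sup>2\<close>, where 136 is twice 68.\<close>
  define s where "s = t / sqrt z"
  have z: "0 < z" using pos by (simp add: z_def)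
  have L: "1 \<le> L" by (simp add: L_def)
  have s: "32 * sqrt L \<le> s" using t2 z by (simp add: s_def L_def pos_le_divide_eq mult_ac)
  have "1 \<le> sqrt L" using L by simp
  then have s32: "32 \<le> s" using s by linarith
  have t: "t = s * sqrt z" using z by (simp add: s_def)
  have "1024 * L = (32 * sqrt L)\<^sup>2" using L by (simp add: power_mult_distrib)
  also have "\<dots> \<le> s\<^sup>2" using s L by (intro power_mono) auto
  finally have sL: "1024 * L \<le> s\<^sup>2" .
  have "ln t = ln s + ln z / 2" using t z s32 by (simp add: ln_mult ln_sqrt)
  also have "\<dots> \<le> ln s + (L - 1)" by (simp add: L_def)
  \<comment> \<open>The tangent of \<open>ln\<close> at 32 has slope \<open>1 / 32\<close>, small
    enough to be absorbed by \<open>s\<^sup>2\<close>; the constant \<open>5 / 2\<close> dominates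
    \<open>5 * ln 2 - 1\<close>.\<close>
  also have "ln s \<le> s / 32 + 5 / 2"
  proof -
    have "ln s = ln (s / 32) + ln 32" using s32 by (simp add: ln_div)
    also have "ln (s / 32) \<le> s / 32 - 1" using s32 by (intro ln_le_minus_one) auto
    also have "ln (32 :: real) = 5 * ln 2" using ln_realpow[of 2 5] by simp
    also have "ln (2 :: real) \<le> 25 / 36" by (rule ln2_le_25_over_36)
    finally show ?thesis by simp
  qed
  finally have ln_t: "1 + ln t \<le> L + s / 32 + 5 / 2" by simp
  have "s * 32 \<le> s * s" "32 * 32 \<le> s * s" using s32 by (intro mult_left_mono mult_mono; simp)+
  \<comment> \<open>Each of \<open>L\<close>, \<open>s / 32\<close> and 1 is at most
    \<open>s\<^sup>2 / 1024\<close>, and \<open>136 * (1 + 1 + 5 / 2)\<close> is below 1024.\<close>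
  then have "136 * (1 + ln t) \<le> s\<^sup>2" using ln_t sL by (simp add: power2_eq_square)
  then have "136 * (1 + ln t) * z \<le> s\<^sup>2 * z" using z by (simp add: mult_right_mono)
  also have "s\<^sup>2 * z = t\<^sup>2" using z by (simp add: t power_mult_distrib)
  finally have "136 * (1 + ln t) * z / t\<^sup>2 \<le> 1" using t0 by simp
  then have "\<epsilon> / 2 * (136 * (1 + ln t) * z / t\<^sup>2) \<le> \<epsilon> / 2 * 1" using pos by (intro mult_left_mono) auto
  moreover have "\<epsilon> / 2 * (136 * (1 + ln t) * z / t\<^sup>2) = 68 * Q * (1 + ln t) / t\<^sup>2"
    using pos t0 by (simp add: z_def field_simps)
  moreover have "4 * P / t \<le> \<epsilon> / 2" using t0 t1 pos by (simp add: field_simps)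
  ultimately show ?thesis by linarith
qed

lemma sum_power_le:
  fixes X :: real
  assumes "real T \<le> X"
  shows "(\<Sum>t=1..T. (real t + 1) ^ k) \<le> 2 ^ k * X ^ Suc k"
proof (cases "T = 0")
  case False
  have "(\<Sum>t=1..T. (real t + 1) ^ k) \<le> (\<Sum>t=1..T. (2 * real T) ^ k)"
    by (intro sum_mono power_mono) auto
  also have "\<dots> = 2 ^ k * real T ^ Suc k" by (simp add: power_mult_distrib)
  also have "\<dots> \<le> 2 ^ k * X ^ Suc k" using assms by (intro mult_left_mono power_mono) auto
  finally show ?thesis .
qed (use assms in simp)

text \<open>The case in which the \<open>Ds\<close> threshold determines \<open>T\<close>. Rounding
  up is paid by \<open>\<epsilon> \<le> G * D\<close>, the first batch term by
  \<open>Ds \<le> D\<close>, and the term with the quotient by \<open>Ds\<^sup>2\<close> gives the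
  target exactly; 4104 is \<open>8 + 2048 + 2048\<close>.\<close>

lemma sum_batch_size_le_Ds:
  fixes \<beta> G D Ds \<epsilon> :: real
  assumes pos: "0 < \<beta>" "0 < G" "0 < D" "0 < \<epsilon>" and Ds: "0 < Ds" "Ds \<le> D" and \<epsilon>: "\<epsilon> \<le> G * D"
    and T: "real T \<le> 8 * (\<beta> * Ds\<^sup>2 / \<epsilon>)"
  shows "real (\<Sum>t=1..T. batch_size \<alpha> \<beta> G D Ds t) \<le> 4104 * (\<beta> * G\<^sup>2 * (D\<^sup>2 * Ds\<^sup>2 / \<epsilon> ^ 3))"
proof -
  let ?W = "\<beta> * G\<^sup>2 * (D\<^sup>2 * Ds\<^sup>2 / \<epsilon> ^ 3)" and ?X = "8 * (\<beta> * Ds\<^sup>2 / \<epsilon>)"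
  let ?a = "(G / (\<beta> * D))\<^sup>2" and ?r = "(G * D / (\<beta> * Ds\<^sup>2))\<^sup>2"
  have "real (\<Sum>t=1..T. batch_size \<alpha> \<beta> G D Ds t) \<le>
      (\<Sum>t=1..T. 1 + (G * (real t + 1) / (\<beta> * D))\<^sup>2 + (G * D * (real t + 1) / (\<beta> * Ds\<^sup>2))\<^sup>2)"
    using batch_size_upper(2)[of Ds] Ds by (simp add: sum_mono)
  also have "\<dots> = real T + (?a + ?r) * (\<Sum>t=1..T. (real t + 1)\<^sup>2)"
    by (simp add: sum.distrib sum_distrib_left power_mult_distrib power_divide distrib_right)
  also have "\<dots> \<le> ?X + (?a + ?r) * (2\<^sup>2 * ?X ^ Suc 2)"
    using sum_power_le[OF T, of 2] T by (intro add_mono mult_left_mono) auto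
  also have "\<dots> = 8 * (\<beta> * Ds\<^sup>2 / \<epsilon>) + 2048 * (?a * (\<beta> * Ds\<^sup>2 / \<epsilon>) ^ 3) + 2048 * (?r * (\<beta> * Ds\<^sup>2 / \<epsilon>) ^ 3)"
  proof -
    have "8 * A + (a + r) * (2\<^sup>2 * (8 * A) ^ Suc 2) = 8 * A + 2048 * (a * A ^ 3) + 2048 * (r * A ^ 3)" for A a r :: real
      by (simp add: eval_nat_numeral algebra_simps)
    then show ?thesis .
  qed
  finally have "real (\<Sum>t=1..T. batch_size \<alpha> \<beta> G D Ds t) \<le> 8 * (\<beta> * Ds\<^sup>2 / \<epsilon>) + 2048 * (?a * (\<beta> * Ds\<^sup>2 / \<epsilon>) ^ 3)
      + 2048 * (?r * (\<beta> * Ds\<^sup>2 / \<epsilon>) ^ 3)" .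
  moreover have "\<beta> * Ds\<^sup>2 / \<epsilon> \<le> ?W"
  proof -
    have "1 \<le> (G * D / \<epsilon>)\<^sup>2" using \<epsilon> pos by (intro one_le_power) simp
    then have "\<beta> * Ds\<^sup>2 / \<epsilon> * 1 \<le> \<beta> * Ds\<^sup>2 / \<epsilon> * (G * D / \<epsilon>)\<^sup>2" using pos by (intro mult_left_mono) auto
    also have "\<dots> = ?W" by (simp add: power2_eq_square power3_eq_cube mult_ac)
    finally show ?thesis by simp
  qed
  moreover have "?r * (\<beta> * Ds\<^sup>2 / \<epsilon>) ^ 3 = ?W"
    using pos Ds by (simp add: power2_eq_square power3_eq_cube field_simps)
  moreover have "?a * (\<beta> * Ds\<^sup>2 / \<epsilon>) ^ 3 \<le> ?W"
  proof -
    have "?a * (\<beta> * Ds\<^sup>2 / \<epsilon>) ^ 3 = \<beta> * G\<^sup>2 * Ds\<^sup>2 / \<epsilon> ^ 3 * (Ds / D * Ds)\<^sup>2"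
      using pos Ds by (simp add: power2_eq_square power3_eq_cube field_simps)
    also have "\<dots> \<le> \<beta> * G\<^sup>2 * Ds\<^sup>2 / \<epsilon> ^ 3 * (1 * D)\<^sup>2"
      using pos Ds by (intro mult_left_mono power_mono mult_mono) auto
    also have "\<dots> = ?W" by (simp add: algebra_simps)
    finally show ?thesis .
  qed
  ultimately show ?thesis by linarith
qed

text \<open>Here \<open>a\<close> and \<open>b\<close> stand for the square roots of \<open>\<alpha>\<close> and \<open>\<epsilon>\<close>, and \<open>l\<close> for that of the logarithmic
  factor, so that all exponents are integers.\<close>

lemma sum_batch_size_le_D:
  fixes a b l \<beta> G D Ds :: real
  assumes pos: "0 < \<beta>" "0 < G" "0 < D" "0 < a" "0 < b" and l: "1 \<le> l" and \<epsilon>: "b\<^sup>2 \<le> G * D"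
    and T: "real T \<le> 32 * (\<beta> * D / (a * b)) * l"
  shows "real (\<Sum>t=1..T. batch_size (a\<^sup>2) \<beta> G D Ds t) \<le> l ^ 6 *
      (131072 * (\<beta> * G\<^sup>2 * (D / (a ^ 3 * b ^ 3))) + 8388640 * (\<beta> * G\<^sup>2 * (D ^ 3 / (a * b ^ 5))))"
proof -
  let ?W2 = "\<beta> * G\<^sup>2 * (D / (a ^ 3 * b ^ 3))" and ?W3 = "\<beta> * G\<^sup>2 * (D ^ 3 / (a * b ^ 5))"
  let ?B = "\<beta> * D / (a * b)" let ?X = "32 * ?B * l"
  let ?s = "(G / (\<beta> * D))\<^sup>2" and ?q = "(a\<^sup>2 * G / (8 * \<beta>\<^sup>2 * D))\<^sup>2"
  have W: "0 \<le> ?W2" "0 \<le> ?W3" using pos by auto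
  have B: "0 \<le> ?B" using pos by simp
  have ll: "l ^ k \<le> l ^ 6" if "k \<le> 6" for k using l that by (intro power_increasing) auto
  have "real (\<Sum>t=1..T. batch_size (a\<^sup>2) \<beta> G D Ds t) \<le>
      (\<Sum>t=1..T. 1 + (G * (real t + 1) / (\<beta> * D))\<^sup>2 + (a\<^sup>2 * G * (real t + 1)\<^sup>2 / (8 * \<beta>\<^sup>2 * D))\<^sup>2)"
    using batch_size_upper(1) by (simp add: sum_mono)
  also have "\<dots> = real T + ?s * (\<Sum>t=1..T. (real t + 1)\<^sup>2) + ?q * (\<Sum>t=1..T. (real t + 1) ^ 4)"
    by (simp add: sum.distrib sum_distrib_left power_mult_distrib power_divide)
  also have "\<dots> \<le> ?X + ?s * (2\<^sup>2 * ?X ^ Suc 2) + ?q * (2 ^ 4 * ?X ^ Suc 4)"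
    using sum_power_le[OF T, of 2] sum_power_le[OF T, of 4] T by (intro add_mono mult_left_mono) auto
  \<comment> \<open>The factor 64 undoes the square of the 8 in the batch size, so that
    \<open>64 * ?q * ?B ^ 5\<close> is exactly \<open>?W3\<close>. The numerals come from
    \<open>4 * 32 ^ 3 = 131072\<close> and \<open>16 * 32 ^ 5 = 64 * 8388608\<close>.\<close>
  also have "\<dots> = 32 * ?B * l ^ 1 + 131072 * (?s * ?B ^ 3) * l ^ 3 + 8388608 * (64 * ?q * ?B ^ 5) * l ^ 5"
  proof -
    have "32 * B * l + s * (2\<^sup>2 * (32 * B * l) ^ Suc 2) + q * (2 ^ 4 * (32 * B * l) ^ Suc 4) =
        32 * B * l ^ 1 + 131072 * (s * B ^ 3) * l ^ 3 + 8388608 * (64 * q * B ^ 5) * l ^ 5" for B s q :: real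
      by (simp add: eval_nat_numeral algebra_simps)
    then show ?thesis .
  qed
  also have "?s * ?B ^ 3 = ?W2"
    using pos by (simp add: power2_eq_square power3_eq_cube field_simps)
  also have "64 * ?q * ?B ^ 5 = ?W3"
    using pos by (simp add: power_divide power_mult_distrib) (simp add: field_simps eval_nat_numeral)
  \<comment> \<open>All powers of \<open>l\<close> are raised to the sixth, which will be the cube
    of the logarithmic factor in \<open>soft_O\<close>.\<close>
  also have "32 * ?B * l ^ 1 + 131072 * ?W2 * l ^ 3 + 8388608 * ?W3 * l ^ 5 \<le>
      32 * ?B * l ^ 6 + 131072 * ?W2 * l ^ 6 + 8388608 * ?W3 * l ^ 6"
    using W B ll[of 1] ll[of 3] ll[of 5] by (intro add_mono mult_left_mono) auto
  also have "\<dots> = l ^ 6 * (32 * ?B + 131072 * ?W2 + 8388608 * ?W3)" by (simp add: algebra_simps)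
  \<comment> \<open>The cost of rounding up, at most one sample per iteration, is paid by
    \<open>b\<^sup>2 \<le> G * D\<close>.\<close>
  also have "?B \<le> ?W3"
  proof -
    have "1 \<le> (G * D / b\<^sup>2)\<^sup>2" using \<epsilon> pos by (intro one_le_power) simp
    then have "?B * 1 \<le> ?B * (G * D / b\<^sup>2)\<^sup>2" by (rule mult_left_mono[OF _ B])
    also have "\<dots> = ?W3" by (simp add: eval_nat_numeral mult_ac)
    finally show ?thesis by simp
  qed
  finally show ?thesis using l by (simp add: mult_left_mono mult_ac add_ac)
qed

section \<open>Choice of the stopping index\<close>

context nep_batched
begin

text \<open>The point \<open>x (Suc T)\<close> results from \<open>T\<close> iterations, that is
  from \<open>T\<close> calls to the nearest extreme point oracle and the batches 1 to
  \<open>T\<close>; hence accuracy is asserted for \<open>t > T\<close>.\<close>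

lemma complexity:
  assumes \<epsilon>: "0 < \<epsilon>" "\<epsilon> \<le> 16 * \<beta>\<^sup>2 * (diameter K)\<^sup>2 / \<alpha>"
  shows "\<exists>T. (\<forall>t>T. expected_gap t \<le> \<epsilon>) \<and>
    real T \<le> soft_O (\<beta>\<^sup>2 * (diameter K)\<^sup>2 / (\<alpha> * \<epsilon>))
      (max (\<beta> * (diameter S)\<^sup>2 / \<epsilon>) (\<beta> * diameter K / sqrt (\<alpha> * \<epsilon>))) \<and>
    real (\<Sum>t=1..T. batch_size \<alpha> \<beta> G (diameter K) (diameter S) t) \<le> soft_O (\<beta>\<^sup>2 * (diameter K)\<^sup>2 / (\<alpha> * \<epsilon>))
      (\<beta> * G\<^sup>2 * Max {(diameter K)\<^sup>2 * (diameter S)\<^sup>2 / \<epsilon> ^ 3,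
                    diameter K / (\<alpha> powr (3/2) * \<epsilon> powr (3/2)),
                    (diameter K) ^ 3 / (\<alpha> powr (1/2) * \<epsilon> powr (5/2))})"
proof -
  define D Ds a b where "D = diameter K" and "Ds = diameter S" and "a = sqrt \<alpha>" and "b = sqrt \<epsilon>"
  have a: "0 < a" "a\<^sup>2 = \<alpha>" and b: "0 < b" "b\<^sup>2 = \<epsilon>" using \<alpha>_pos \<epsilon> by (auto simp: a_def b_def)
  have powr: "\<alpha> powr (3/2) = a ^ 3" "\<alpha> powr (1/2) = a" "\<epsilon> powr (3/2) = b ^ 3" "\<epsilon> powr (5/2) = b ^ 5"
    using \<alpha>_pos \<epsilon> unfolding a_def b_def
    by (simp_all add: powr_half_sqrt[symmetric] powr_power)
  have D: "0 < D" and Ds: "0 \<le> Ds" "Ds \<le> D"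
    using diameter_pos diameter_S_nonneg diameter_S_le by (auto simp: D_def Ds_def)
  define z l where "z = \<beta>\<^sup>2 * D\<^sup>2 / (\<alpha> * \<epsilon>)" and "l = sqrt (1 + \<bar>ln z\<bar>)"
  have l: "1 \<le> l" "l\<^sup>2 = 1 + \<bar>ln z\<bar>" by (auto simp: l_def)
  then have l6: "(1 + \<bar>ln z\<bar>) ^ 3 = l ^ 6" by (simp add: power_mult[symmetric] flip: l(2))
  define A B where "A = \<beta> * Ds\<^sup>2 / \<epsilon>" and "B = \<beta> * D / (a * b)"
  have A: "0 \<le> A" and B: "0 < B" using \<beta>_pos D a b \<epsilon> by (auto simp: A_def B_def)
  have sqrt_ab: "sqrt (\<alpha> * \<epsilon>) = a * b" by (simp add: a_def b_def real_sqrt_mult)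
  \<comment> \<open>This identifies the square root in the threshold of \<open>log_rate_le\<close>
    with the second term of the iteration bound.\<close>
  have sqrt_z: "sqrt z = B"
    using \<beta>_pos D by (simp add: z_def B_def a_def b_def real_sqrt_divide real_sqrt_mult)
  define W1 W2 W3 where "W1 = D\<^sup>2 * Ds\<^sup>2 / \<epsilon> ^ 3" and "W2 = D / (a ^ 3 * b ^ 3)" and "W3 = D ^ 3 / (a * b ^ 5)"
  define W where "W = Max {W1, W2, W3}"
  have W: "0 \<le> \<beta> * G\<^sup>2 * W" "\<beta> * G\<^sup>2 * W1 \<le> \<beta> * G\<^sup>2 * W" "\<beta> * G\<^sup>2 * W2 \<le> \<beta> * G\<^sup>2 * W" "\<beta> * G\<^sup>2 * W3 \<le> \<beta> * G\<^sup>2 * W"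
  proof -
    have "W1 \<le> W" "W2 \<le> W" "W3 \<le> W" by (simp_all add: W_def)
    then show "\<beta> * G\<^sup>2 * W1 \<le> \<beta> * G\<^sup>2 * W" "\<beta> * G\<^sup>2 * W2 \<le> \<beta> * G\<^sup>2 * W" "\<beta> * G\<^sup>2 * W3 \<le> \<beta> * G\<^sup>2 * W"
      using \<beta>_pos by (auto intro!: mult_left_mono)
    have "0 \<le> W2" using D a b by (simp add: W2_def)
    with \<open>W2 \<le> W\<close> show "0 \<le> \<beta> * G\<^sup>2 * W" using \<beta>_pos by simp
  qed
  have l61: "1 \<le> l ^ 6" using l by (simp add: one_le_power)
  have "\<exists>T. (\<forall>t>T. expected_gap t \<le> \<epsilon>) \<and> real T \<le> 10 ^ 7 * l ^ 6 * max A B \<and>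
      real (\<Sum>t=1..T. batch_size \<alpha> \<beta> G D Ds t) \<le> 10 ^ 7 * l ^ 6 * (\<beta> * G\<^sup>2 * W)"
  proof (cases "G * D \<le> \<epsilon>")
    case True
    have "\<forall>t>0. expected_gap t \<le> \<epsilon>"
    proof (intro allI impI)
      fix t :: nat assume "0 < t"
      then show "expected_gap t \<le> \<epsilon>" using expected_gap_le[of t] True by (simp add: D_def)
    qed
    then show ?thesis using A B W(1) l61 by (intro exI[of _ 0]) (auto simp: max_def)
  next
    case False
    \<comment> \<open>\<open>X\<close> is the larger of the two thresholds of
      \<open>log_rate_le\<close>. Rounding down keeps \<open>T \<le> X\<close> for the counts, while
      every \<open>t > T\<close> is still at least \<open>X\<close>.\<close>
    define X T where "X = max (8 * A) (32 * B * l)" and "T = nat \<lfloor>X\<rfloor>"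
    have X0: "0 \<le> X" using A by (simp add: X_def le_max_iff_disj)
    then have TX: "real T \<le> X" by (simp add: T_def)
    \<comment> \<open>The upper bound on \<open>\<epsilon>\<close> enters here: it makes
      \<open>X\<close> at least 8, so that every \<open>t > T\<close> lies in the range of
      \<open>expected_gap_fast\<close>.\<close>
    have "1 / 4 \<le> B"
    proof -
      have "\<epsilon> * \<alpha> \<le> 16 * \<beta>\<^sup>2 * D\<^sup>2" using \<epsilon>(2) \<alpha>_pos by (simp add: D_def pos_le_divide_eq)
      then have "(1 / 4)\<^sup>2 \<le> z" using \<alpha>_pos \<epsilon>(1) by (simp add: z_def pos_le_divide_eq power2_eq_square mult_ac)
      then show ?thesis unfolding sqrt_z[symmetric] by (rule real_le_rsqrt)
    qed
    then have "8 * 1 \<le> 32 * B * l" using l(1) by (intro mult_mono) auto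
    then have T8: "8 \<le> T" by (simp add: T_def X_def le_nat_iff le_floor_iff le_max_iff_disj)
    have "expected_gap t \<le> \<epsilon>" if "T < t" for t
    proof -
      have tX: "X \<le> real t" using that by (simp add: T_def) linarith
      have "expected_gap t \<le> 4 * (\<beta> * Ds\<^sup>2) / t + 68 * (\<beta>\<^sup>2 * D\<^sup>2 / \<alpha>) * (1 + ln t) / (real t)\<^sup>2"
        using expected_gap_fast[of t] T8 that by (simp add: D_def Ds_def)
      also have "\<dots> \<le> \<epsilon>"
      proof (rule log_rate_le)
        show "0 < \<beta>\<^sup>2 * D\<^sup>2 / \<alpha>" "0 < \<epsilon>" "0 < real t" using \<beta>_pos D \<alpha>_pos \<epsilon> that by auto
        show "8 * (\<beta> * Ds\<^sup>2 / \<epsilon>) \<le> real t" using tX by (simp add: X_def A_def)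
        have "\<beta>\<^sup>2 * D\<^sup>2 / \<alpha> / \<epsilon> = z" by (simp add: z_def)
        then show "32 * sqrt (\<beta>\<^sup>2 * D\<^sup>2 / \<alpha> / \<epsilon>) * sqrt (1 + \<bar>ln (\<beta>\<^sup>2 * D\<^sup>2 / \<alpha> / \<epsilon>)\<bar>) \<le> real t"
          using tX by (simp add: sqrt_z l_def[symmetric] X_def)
      qed
      finally show ?thesis .
    qed
    moreover have "real T \<le> 10 ^ 7 * l ^ 6 * max A B"
    proof -
      have "l * 1 \<le> l ^ 6" using l(1) power_increasing[of 1 6 l] by simp
      then have "32 * (B * l) \<le> 10 ^ 7 * (max A B * l ^ 6)" using B l(1) by (intro mult_mono) auto
      moreover have "8 * (A * 1) \<le> 10 ^ 7 * (max A B * l ^ 6)" using A l61 by (intro mult_mono) auto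
      ultimately have "X \<le> 10 ^ 7 * (max A B * l ^ 6)" by (simp add: X_def mult.assoc)
      then show ?thesis using TX by (simp add: mult_ac)
    qed
    moreover have "real (\<Sum>t=1..T. batch_size \<alpha> \<beta> G D Ds t) \<le> 10 ^ 7 * l ^ 6 * (\<beta> * G\<^sup>2 * W)"
    \<comment> \<open>The larger threshold decides which batch size bound is affordable. If it is
      the first one, \<open>A > 0\<close> forces \<open>Ds \<noteq> 0\<close>.\<close>
    proof (cases "32 * B * l \<le> 8 * A")
      case True
      then have "0 < A" using B l(1) by (smt (verit) mult_pos_pos)
      then have "Ds \<noteq> 0" by (auto simp: A_def)
      moreover have "real T \<le> 8 * (\<beta> * Ds\<^sup>2 / \<epsilon>)" using TX True by (simp add: X_def A_def)
      ultimately have "real (\<Sum>t=1..T. batch_size \<alpha> \<beta> G D Ds t) \<le> 4104 * (\<beta> * G\<^sup>2 * W1)"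
        using sum_batch_size_le_Ds[of \<beta> G D \<epsilon> Ds T \<alpha>] \<beta>_pos G_pos D \<epsilon> Ds False by (simp add: W1_def)
      also have "\<dots> \<le> 10000000 * (\<beta> * G\<^sup>2 * W)" using W(1,2) by linarith
      also have "\<dots> = 1 * (10 ^ 7 * (\<beta> * G\<^sup>2 * W))" by simp
      also have "\<dots> \<le> l ^ 6 * (10 ^ 7 * (\<beta> * G\<^sup>2 * W))"
        using W(1) by (intro mult_right_mono l61) simp
      finally show ?thesis by (simp add: mult_ac)
    next
      case F: False
      then have T: "real T \<le> 32 * (\<beta> * D / (a * b)) * l" using TX by (simp add: X_def B_def)
      have "b\<^sup>2 \<le> G * D" using False by (simp add: b)
      from sum_batch_size_le_D[OF \<beta>_pos G_pos D a(1) b(1) l(1) this T, of Ds]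
      have "real (\<Sum>t=1..T. batch_size \<alpha> \<beta> G D Ds t) \<le>
          l ^ 6 * (131072 * (\<beta> * G\<^sup>2 * W2) + 8388640 * (\<beta> * G\<^sup>2 * W3))"
        by (simp add: a W2_def W3_def)
      also have "\<dots> \<le> l ^ 6 * (10000000 * (\<beta> * G\<^sup>2 * W))"
      proof (rule mult_left_mono)
        show "131072 * (\<beta> * G\<^sup>2 * W2) + 8388640 * (\<beta> * G\<^sup>2 * W3) \<le> 10000000 * (\<beta> * G\<^sup>2 * W)"
          using W by linarith
        show "0 \<le> l ^ 6" using l61 by linarith
      qed
      finally show ?thesis by (simp add: mult_ac)
    qed
    ultimately show ?thesis by blast
  qed
  then show ?thesis
    unfolding soft_O_def powr D_def[symmetric] Ds_def[symmetric] sqrt_ab z_def[symmetric] l6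
      A_def[symmetric] B_def[symmetric] W1_def[symmetric] W2_def[symmetric] W3_def[symmetric] W_def[symmetric] .
qed

end

section \<open>Specialization to \<open>Sstar\<close> and the prescribed run\<close>

theorem theorem5:
  fixes K :: "'a::euclidean_space set" and f :: "'a \<Rightarrow> real" and f' :: "'a \<Rightarrow> 'a"
    and \<alpha> \<beta> G \<epsilon> D Ds :: real and Sstar :: "'a set" and Orc :: "'a \<Rightarrow> 'a measure"
    and M :: "'w measure" and F :: "nat \<Rightarrow> 'w measure"
    and x v :: "nat \<Rightarrow> 'w \<Rightarrow> 'a" and g :: "nat \<Rightarrow> nat \<Rightarrow> 'w \<Rightarrow> 'a"
  defines "D \<equiv> diameter K" and "Ds \<equiv> diameter Sstar"
  assumes "convex K" and "compact K"
    and "convex_on K f" and "\<beta> > 0" and "smooth_over \<beta> K f f'"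
    and "G > 0" and "stochastic_gradient_oracle K f' G Orc"
    and "\<alpha> > 0" and "quadratic_growth \<alpha> K f"
    and "is_arg_min diameter
           (\<lambda>S. S \<subseteq> {u. u extreme_point_of K} \<and> minimizers K f \<subseteq> convex hull S) Sstar"
    and "stochastic_nep_frank_wolfe M F K Orc \<beta> (\<lambda>t. 2 / (real t + 1))
           (batch_size \<alpha> \<beta> G D Ds) x v g"
    and "0 < \<epsilon>" and "\<epsilon> \<le> 16 * \<beta>\<^sup>2 * D\<^sup>2 / \<alpha>"
  shows "\<exists>T. (\<forall>t>T. (\<integral>\<omega>. (f (x t \<omega>) - (INF y\<in>K. f y)) \<partial>M) \<le> \<epsilon>) \<and>
    real T \<le> soft_O (\<beta>\<^sup>2 * D\<^sup>2 / (\<alpha> * \<epsilon>))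
      (max (\<beta> * Ds\<^sup>2 / \<epsilon>) (\<beta> * D / sqrt (\<alpha> * \<epsilon>))) \<and>
    real (\<Sum>t=1..T. batch_size \<alpha> \<beta> G D Ds t) \<le> soft_O (\<beta>\<^sup>2 * D\<^sup>2 / (\<alpha> * \<epsilon>))
      (\<beta> * G\<^sup>2 * Max {D\<^sup>2 * Ds\<^sup>2 / \<epsilon> ^ 3,
                    D / (\<alpha> powr (3/2) * \<epsilon> powr (3/2)),
                    D ^ 3 / (\<alpha> powr (1/2) * \<epsilon> powr (5/2))})"
proof -
  interpret fw: stochastic_nep_frank_wolfe M F K Orc \<beta> "\<lambda>t. 2 / (real t + 1)"
    "batch_size \<alpha> \<beta> G (diameter K) (diameter Sstar)" x v g
    using assms(13) unfolding D_def Ds_def .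
  \<comment> \<open>A probability space is nonempty and every run starts at an extreme point, so
    \<open>K\<close> is nonempty.\<close>
  obtain \<omega> where "\<omega> \<in> space M" using fw.not_empty by blast
  then have "K \<noteq> {}" using fw.init by (auto simp: extreme_point_of_def)
  then interpret smooth_convex_problem K f f' \<alpha> \<beta> Sstar
    using assms by unfold_locales (auto simp: is_arg_min_def)
  \<comment> \<open>With diameter 0 the upper bound on \<open>\<epsilon>\<close> would be 0,
    contradicting \<open>0 < \<epsilon>\<close>.\<close>
  have "diameter K \<noteq> 0" using assms(14,15) by (auto simp: D_def)
  then have D: "0 < diameter K"
    using diameter_ge_0[OF compact_imp_bounded[OF compact_K]] by linarith
  interpret nep_batched K f f' \<alpha> \<beta> Sstar M F Orc x v g G
  proof unfold_locales
    fix t :: nat assume "1 \<le> t"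
    then show "0 \<le> 2 / (real t + 1) \<and> 2 / (real t + 1) \<le> 1" by simp
    show "1 \<le> batch_size \<alpha> \<beta> G (diameter K) (diameter Sstar) t"
      using \<open>1 \<le> t\<close> assms D diameter_S_nonneg by (intro batch_size_lower)
  qed (use assms D in auto)
  show ?thesis
    using complexity[OF assms(14,15)[unfolded D_def]] unfolding D_def Ds_def expected_gap_def gap_def .
qed

end
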